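(* Let $\mathcal V$ be an integral commutative quantale. The discrete $\mathcal V\text{-}\mathsf{cat}$-functor $D:\mathsf{Set}\to\mathcal V\text{-}\mathsf{cat}$ is dense, and the diagrams $(N,DF_{\mathcal X})$, with $\mathcal X$ ranging over all small $\mathcal V$-categories, form a density presentation of $D:\mathsf{Set}\to\mathcal V\text{-}\mathsf{cat}$.
   Context: $\mathcal V=(\mathcal V_o,\otimes,e,[-,-])$ is a commutative quantale: a complete lattice with a commutative, associative, monotone operation $\otimes$ with unit $e$, such that each $-\otimes r$ has a right adjoint $[r,-]$; it is assumed non-trivial ($e\neq\bot$), and it is integral if $e=\top$. A (small) $\mathcal V$-category $\mathcal X$ is a set of objects together with elements $\mathcal X(x',x)\in\mathcal V_o$ satisfying $e\le\mathcal X(x,x)$ and $\mathcal X(x',x)\otimes\mathcal X(x'',x')\le\mathcal X(x'',x)$; a $\mathcal V$-functor $f:\mathcal X\to\mathcal Y$ is a map on objects with $\mathcal X(x',x)\le\mathcal Y(fx',fx)$. $\mathcal V\text{-}\mathsf{cat}$ is the symmetric monoidal closed category of small $\mathcal V$-categories and $\mathcal V$-functors, with $(\mathcal X\otimes\mathcal Y)((x',y'),(x,y))=\mathcal X(x',x)\otimes\mathcal Y(y',y)$, unit $\mathbb 1$ (one object $0$ with $\mathbb 1(0,0)=e$), and internal hom $[\mathcal Y,\mathcal Z]=\mathcal V\text{-}\mathsf{cat}(\mathcal Y,\mathcal Z)$ of $\mathcal V$-functors with $[\mathcal Y,\mathcal Z](f,g)=\bigwedge_y\mathcal Z(fy,gy)$;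 it is enriched over itself. $\mathsf{Set}$ is regarded as a $\mathcal V\text{-}\mathsf{cat}$-category whose homs are the discrete $\mathcal V$-categories (distance $e$ between equal objects, $\bot$ otherwise) on the sets of functions; $D$ sends a set to the discrete $\mathcal V$-category on it. For integral $\mathcal V$, $D$ is fully faithful. $\mathbb N$ is the free $\mathcal V\text{-}\mathsf{cat}$-category on the ordinary category with objects all $r\in\mathcal V_o$ and an extra object $\mathsf o$, and non-identity arrows $\delta^r_0,\delta^r_1:r\to\mathsf o$. $N:\mathbb N^{op}\to\mathcal V\text{-}\mathsf{cat}$ sends $\mathsf o$ to $\mathbb 1$ and $r$ to $\mathbb 2_r$, the $\mathcal V$-category with objects $0,1$, self-distances $e$, $\mathbb 2_r(0,1)=r$, $\mathbb 2_r(1,0)=\bot$; $N\delta^r_i$ picks $i$. $F_{\mathcal X}:\mathbb N\to\mathsf{Set}$ sends $\mathsf o$ to the set $X_{\mathsf o}$ of objects of $\mathcal X$, $r$ to $X_r=\{(x',x)\mid r\le\mathcal X(x',x)\}$, and $\delta^r_0,\delta^r_1$ to the first and second projections. The diagram $(N,DF_{\mathcal X})$ has weighted colimit $N*DF_{\mathcal X}$ in $\mathcal V\text{-}\mathsf{cat}$. A $\mathcal V\text{-}\mathsf{cat}$-functor $J:\mathbb A\to\mathbb B$ is dense if the identity on $\mathbb B$ is the (pointwise, enriched) left Kan extension of $J$ along $J$ with identity unit; equivalently, $B\mapsto\mathbb B(J-,B)$ is fully faithful. A density presentation (Kelly) of a fully faithful dense $J:\mathbb A\to\mathbb B$ is a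 family of pairs (weight $W_\gamma:\mathbb K_\gamma^{op}\to\mathcal V\text{-}\mathsf{cat}$, diagram $P_\gamma:\mathbb K_\gamma\to\mathbb B$) such that every colimit $W_\gamma*P_\gamma$ exists in $\mathbb B$ and is preserved by all functors $\mathbb B(JA,-):\mathbb B\to\mathcal V\text{-}\mathsf{cat}$, $A\in\mathbb A$, and such that $\mathbb B$ is the closure of $\mathbb A$ under these colimits (the smallest full replete subcategory of $\mathbb B$ that contains the objects $JA$ and contains $W_\gamma*P_\gamma$ whenever $P_\gamma$ takes its values in it is $\mathbb B$ itself). *)

theory Defs
  imports Main "HOL-Library.FuncSet"
begin

section \<open>A universe of small sets\<close>

text \<open>
  \<open>Set\<close> and \<open>V-cat\<close> are categories of \<^emph>\<open>small\<close> objects.  A type of the following class is a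
  universe of sets: its elements are the small sets.  The axioms are those of ZF with
  second-order separation and replacement; neither foundation nor infinity is used, so any
  Grothendieck universe, and the class of all sets, is covered.
\<close>

class set_universe =
  fixes elts :: "'a \<Rightarrow> 'a set"
  assumes extensionality: "elts x = elts y \<Longrightarrow> x = y"
    and pairing: "\<exists>z. elts z = {x, y}"
    and union: "\<exists>z. elts z = (\<Union>y\<in>elts x. elts y)"
    and powerset: "\<exists>z. elts z = {y. elts y \<subseteq> elts x}"
    and separation: "A \<subseteq> elts x \<Longrightarrow> \<exists>z. elts z = A"
    and replacement: "\<exists>z. elts z = f ` elts x"

definition small :: "'u::set_universe set \<Rightarrow> bool" where
  "small A \<longleftrightarrow> (\<exists>x. elts x = A)"

text \<open>\<open>mk A\<close> is meaningful only when \<open>A\<close> is small.\<close>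

definition mk :: "'u::set_universe set \<Rightarrow> 'u" where
  "mk A = (THE x. elts x = A)"

definition pair :: "'u::set_universe \<Rightarrow> 'u \<Rightarrow> 'u" where
  "pair a b = mk {mk {a}, mk {a, b}}"

definition pfst :: "'u::set_universe \<Rightarrow> 'u" where
  "pfst p = (THE a. \<exists>b. p = pair a b)"

definition psnd :: "'u::set_universe \<Rightarrow> 'u" where
  "psnd p = (THE b. \<exists>a. p = pair a b)"

definition u0 :: "'u::set_universe" where
  "u0 = mk {}"

definition u1 :: "'u::set_universe" where
  "u1 = mk {u0}"

text \<open>\<open>lam A f\<close> is the graph of \<open>f\<close> restricted to \<open>A\<close>, as an element of the universe.\<close>

definition lam :: "'u::set_universe set \<Rightarrow> ('u \<Rightarrow> 'u) \<Rightarrow> 'u" where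
  "lam A f = mk ((\<lambda>x. pair x (f x)) ` A)"

definition app :: "'u::set_universe \<Rightarrow> 'u \<Rightarrow> 'u" where
  "app f x = (THE y. pair x y \<in> elts f)"


section \<open>Commutative quantales\<close>

text \<open>
  The tensor is \<open>*\<close>, its unit \<open>e\<close> is \<open>1\<close>, and \<open>ihom r c\<close> is \<open>[r,c]\<close>.  The adjunction makes
  \<open>*\<close> monotone (indeed join preserving) in each variable.
\<close>

class comm_quantale = complete_lattice + comm_monoid_mult +
  fixes ihom :: "'a \<Rightarrow> 'a \<Rightarrow> 'a"
  assumes adjunction: "a * r \<le> c \<longleftrightarrow> a \<le> ihom r c"
    and one_neq_bot: "1 \<noteq> bot"


section \<open>Categories enriched in a quantale\<close>

text \<open>The objects form a set over an arbitrary type, so that large ones are included.\<close>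

record ('a, 'v) vcat =
  ob :: "'a set"
  dist :: "'a \<Rightarrow> 'a \<Rightarrow> 'v"

text \<open>
  The value of \<open>dist\<close> outside the objects is fixed to be \<open>bot\<close>, so that a category with given
  objects and distances is represented by exactly one record.
\<close>

definition is_vcat :: "('a, 'v::comm_quantale) vcat \<Rightarrow> bool" where
  "is_vcat X \<longleftrightarrow>
     (\<forall>x\<in>ob X. 1 \<le> dist X x x) \<and>
     (\<forall>x\<in>ob X. \<forall>x'\<in>ob X. \<forall>x''\<in>ob X. dist X x' x * dist X x'' x' \<le> dist X x'' x) \<and>
     (\<forall>x x'. \<not> (x \<in> ob X \<and> x' \<in> ob X) \<longrightarrow> dist X x x' = bot)"

definition small_vcat :: "('u::set_universe, 'v::comm_quantale) vcat \<Rightarrow> bool" where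
  "small_vcat X \<longleftrightarrow> is_vcat X \<and> small (ob X)"

definition vfunctor ::
  "('a, 'v::comm_quantale) vcat \<Rightarrow> ('b, 'v) vcat \<Rightarrow> ('a \<Rightarrow> 'b) \<Rightarrow> bool" where
  "vfunctor X Y f \<longleftrightarrow>
     (\<forall>x\<in>ob X. f x \<in> ob Y) \<and>
     (\<forall>x'\<in>ob X. \<forall>x\<in>ob X. dist X x' x \<le> dist Y (f x') (f x))"

definition vcat_iso ::
  "('a, 'v::comm_quantale) vcat \<Rightarrow> ('b, 'v) vcat \<Rightarrow> ('a \<Rightarrow> 'b) \<Rightarrow> bool" where
  "vcat_iso X Y f \<longleftrightarrow> vfunctor X Y f \<and>
     (\<exists>g. vfunctor Y X g \<and> (\<forall>x\<in>ob X. g (f x) = x) \<and> (\<forall>y\<in>ob Y. f (g y) = y))"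

definition vtensor ::
  "('a, 'v::comm_quantale) vcat \<Rightarrow> ('b, 'v) vcat \<Rightarrow> ('a \<times> 'b, 'v) vcat" where
  "vtensor X Y = \<lparr>ob = ob X \<times> ob Y,
     dist = (\<lambda>(x', y') (x, y). dist X x' x * dist Y y' y)\<rparr>"

definition vdiscrete :: "'a set \<Rightarrow> ('a, 'v::comm_quantale) vcat" where
  "vdiscrete A = \<lparr>ob = A, dist = (\<lambda>x y. if x \<in> A \<and> x = y then 1 else bot)\<rparr>"

text \<open>The internal hom; its objects are the graphs of the functors.\<close>

definition vhom ::
  "('u::set_universe, 'v::comm_quantale) vcat \<Rightarrow> ('u, 'v) vcat \<Rightarrow> ('u, 'v) vcat" where
  "vhom Y Z = (let H = {lam (ob Y) f | f. vfunctor Y Z f} in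
     \<lparr>ob = H,
      dist = (\<lambda>f g. if f \<in> H \<and> g \<in> H then (INF y\<in>ob Y. dist Z (app f y) (app g y)) else bot)\<rparr>)"

definition vunit :: "('u::set_universe, 'v::comm_quantale) vcat" where
  "vunit = vdiscrete {u0}"

definition vtwo :: "'v::comm_quantale \<Rightarrow> ('u::set_universe, 'v) vcat" where
  "vtwo r = \<lparr>ob = {u0, u1},
     dist = (\<lambda>x y. if x \<in> {u0, u1} \<and> x = y then 1
                   else if x = u0 \<and> y = u1 then r else bot)\<rparr>"


section \<open>Categories enriched in V-cat\<close>

text \<open>
  \<open>Comp A a b c\<close> is the composition \<open>A(b,c) \<otimes> A(a,b) \<rightarrow> A(a,c)\<close>.  A functor from the unit
  into a V-category is just an object of it, hence \<open>Id A a\<close> is an object of \<open>A(a,a)\<close>.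
\<close>

record ('o, 'u, 'v) vccat =
  Obj :: "'o set"
  Hom :: "'o \<Rightarrow> 'o \<Rightarrow> ('u, 'v) vcat"
  Id :: "'o \<Rightarrow> 'u"
  Comp :: "'o \<Rightarrow> 'o \<Rightarrow> 'o \<Rightarrow> 'u \<Rightarrow> 'u \<Rightarrow> 'u"

definition is_vccat :: "('o, 'u::set_universe, 'v::comm_quantale) vccat \<Rightarrow> bool" where
  "is_vccat A \<longleftrightarrow>
     (\<forall>a\<in>Obj A. \<forall>b\<in>Obj A. small_vcat (Hom A a b)) \<and>
     (\<forall>a\<in>Obj A. Id A a \<in> ob (Hom A a a)) \<and>
     (\<forall>a\<in>Obj A. \<forall>b\<in>Obj A. \<forall>c\<in>Obj A.
        vfunctor (vtensor (Hom A b c) (Hom A a b)) (Hom A a c) (\<lambda>(g, f). Comp A a b c g f)) \<and>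
     (\<forall>a\<in>Obj A. \<forall>b\<in>Obj A. \<forall>f\<in>ob (Hom A a b).
        Comp A a b b (Id A b) f = f \<and> Comp A a a b f (Id A a) = f) \<and>
     (\<forall>a\<in>Obj A. \<forall>b\<in>Obj A. \<forall>c\<in>Obj A. \<forall>d\<in>Obj A.
        \<forall>f\<in>ob (Hom A a b). \<forall>g\<in>ob (Hom A b c). \<forall>h\<in>ob (Hom A c d).
          Comp A a b d (Comp A b c d h g) f = Comp A a c d h (Comp A a b c g f))"

record ('o, 'p, 'u) vcfun =
  FObj :: "'o \<Rightarrow> 'p"
  FMap :: "'o \<Rightarrow> 'o \<Rightarrow> 'u \<Rightarrow> 'u"

definition is_vcfun ::
  "('o, 'u::set_universe, 'v::comm_quantale) vccat \<Rightarrow> ('p, 'u, 'v) vccat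
     \<Rightarrow> ('o, 'p, 'u) vcfun \<Rightarrow> bool" where
  "is_vcfun A B F \<longleftrightarrow> is_vccat A \<and> is_vccat B \<and>
     (\<forall>a\<in>Obj A. FObj F a \<in> Obj B) \<and>
     (\<forall>a\<in>Obj A. \<forall>b\<in>Obj A. vfunctor (Hom A a b) (Hom B (FObj F a) (FObj F b)) (FMap F a b)) \<and>
     (\<forall>a\<in>Obj A. FMap F a a (Id A a) = Id B (FObj F a)) \<and>
     (\<forall>a\<in>Obj A. \<forall>b\<in>Obj A. \<forall>c\<in>Obj A. \<forall>f\<in>ob (Hom A a b). \<forall>g\<in>ob (Hom A b c).
        FMap F a c (Comp A a b c g f) =
        Comp B (FObj F a) (FObj F b) (FObj F c) (FMap F b c g) (FMap F a b f))"

definition vcfun_id :: "('o, 'o, 'u) vcfun" where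
  "vcfun_id = \<lparr>FObj = (\<lambda>a. a), FMap = (\<lambda>a b f. f)\<rparr>"

definition vcfun_comp ::
  "('p, 'q, 'u) vcfun \<Rightarrow> ('o, 'p, 'u) vcfun \<Rightarrow> ('o, 'q, 'u) vcfun" where
  "vcfun_comp G F = \<lparr>FObj = (\<lambda>a. FObj G (FObj F a)),
     FMap = (\<lambda>a b f. FMap G (FObj F a) (FObj F b) (FMap F a b f))\<rparr>"

definition vc_op :: "('o, 'u, 'v) vccat \<Rightarrow> ('o, 'u, 'v) vccat" where
  "vc_op A = \<lparr>Obj = Obj A, Hom = (\<lambda>a b. Hom A b a), Id = Id A,
     Comp = (\<lambda>a b c g f. Comp A c b a f g)\<rparr>"

definition vcfun_op :: "('o, 'p, 'u) vcfun \<Rightarrow> ('o, 'p, 'u) vcfun" where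
  "vcfun_op F = \<lparr>FObj = FObj F, FMap = (\<lambda>a b. FMap F b a)\<rparr>"

definition fully_faithful ::
  "('o, 'u::set_universe, 'v::comm_quantale) vccat \<Rightarrow> ('p, 'u, 'v) vccat
     \<Rightarrow> ('o, 'p, 'u) vcfun \<Rightarrow> bool" where
  "fully_faithful A B F \<longleftrightarrow> is_vcfun A B F \<and>
     (\<forall>a\<in>Obj A. \<forall>b\<in>Obj A. vcat_iso (Hom A a b) (Hom B (FObj F a) (FObj F b)) (FMap F a b))"

definition iso_objects ::
  "('o, 'u::set_universe, 'v::comm_quantale) vccat \<Rightarrow> 'o \<Rightarrow> 'o \<Rightarrow> bool" where
  "iso_objects B b c \<longleftrightarrow>
     (\<exists>f\<in>ob (Hom B b c). \<exists>g\<in>ob (Hom B c b).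
        Comp B b c b g f = Id B b \<and> Comp B c b c f g = Id B c)"

text \<open>
  The V-category \<open>[A,B](F,G)\<close>, possibly large.  Enriched naturality compares two V-functors
  out of \<open>A(a,b)\<close>, which are equal as soon as they agree on objects; so it amounts to
  naturality in the ordinary sense.
\<close>

definition nat_trans ::
  "('o, 'u::set_universe, 'v::comm_quantale) vccat \<Rightarrow> ('p, 'u, 'v) vccat
     \<Rightarrow> ('o, 'p, 'u) vcfun \<Rightarrow> ('o, 'p, 'u) vcfun \<Rightarrow> ('o \<Rightarrow> 'u) set" where
  "nat_trans A B F G =
     {\<alpha> \<in> (\<Pi>\<^sub>E a\<in>Obj A. ob (Hom B (FObj F a) (FObj G a))).
        \<forall>a\<in>Obj A. \<forall>b\<in>Obj A. \<forall>f\<in>ob (Hom A a b).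
          Comp B (FObj F a) (FObj G a) (FObj G b) (FMap G a b f) (\<alpha> a) =
          Comp B (FObj F a) (FObj F b) (FObj G b) (\<alpha> b) (FMap F a b f)}"

definition nat_vcat ::
  "('o, 'u::set_universe, 'v::comm_quantale) vccat \<Rightarrow> ('p, 'u, 'v) vccat
     \<Rightarrow> ('o, 'p, 'u) vcfun \<Rightarrow> ('o, 'p, 'u) vcfun \<Rightarrow> ('o \<Rightarrow> 'u, 'v) vcat" where
  "nat_vcat A B F G = \<lparr>ob = nat_trans A B F G,
     dist = (\<lambda>\<alpha> \<beta>. if \<alpha> \<in> nat_trans A B F G \<and> \<beta> \<in> nat_trans A B F G
                    then (INF a\<in>Obj A. dist (Hom B (FObj F a) (FObj G a)) (\<alpha> a) (\<beta> a))
                    else bot)\<rparr>"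

definition VCat :: "(('u::set_universe, 'v::comm_quantale) vcat, 'u, 'v) vccat" where
  "VCat = \<lparr>Obj = {X. small_vcat X}, Hom = vhom, Id = (\<lambda>X. lam (ob X) (\<lambda>x. x)),
     Comp = (\<lambda>X Y Z g f. lam (ob X) (\<lambda>x. app g (app f x)))\<rparr>"

text \<open>The representable functors \<open>B(-,c)\<close>, defined on the opposite of \<open>B\<close>, and \<open>B(a,-)\<close>.\<close>

definition hom_to ::
  "('p, 'u::set_universe, 'v::comm_quantale) vccat \<Rightarrow> 'p \<Rightarrow> ('p, ('u, 'v) vcat, 'u) vcfun" where
  "hom_to B c = \<lparr>FObj = (\<lambda>b. Hom B b c),
     FMap = (\<lambda>b b' f. lam (ob (Hom B b c)) (\<lambda>g. Comp B b' b c g f))\<rparr>"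

definition hom_from ::
  "('p, 'u::set_universe, 'v::comm_quantale) vccat \<Rightarrow> 'p \<Rightarrow> ('p, ('u, 'v) vcat, 'u) vcfun" where
  "hom_from B a = \<lparr>FObj = (\<lambda>b. Hom B a b),
     FMap = (\<lambda>b b' f. lam (ob (Hom B a b)) (\<lambda>g. Comp B a b b' f g))\<rparr>"

text \<open>\<open>B(P-,c)\<close>, defined on the opposite of the domain of \<open>P\<close>.\<close>

definition hom_along ::
  "('p, 'u::set_universe, 'v::comm_quantale) vccat \<Rightarrow> ('k, 'p, 'u) vcfun \<Rightarrow> 'p
     \<Rightarrow> ('k, ('u, 'v) vcat, 'u) vcfun" where
  "hom_along B P c = vcfun_comp (hom_to B c) (vcfun_op P)"


section \<open>Weighted colimits\<close>

text \<open>
  \<open>C\<close> is the colimit \<open>W * P\<close> with unit \<open>\<mu> : W \<rightarrow> B(P-,C)\<close>: the V-functor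
  \<open>B(C,b) \<rightarrow> [K\<^sup>o\<^sup>p,V-cat](W, B(P-,b))\<close> which corresponds to \<open>\<mu>\<close> by the Yoneda lemma, that is,
  which sends \<open>f\<close> to \<open>B(P-,f) \<circ> \<mu>\<close>, is an isomorphism for every \<open>b\<close>.
\<close>

definition is_weighted_colimit ::
  "('k, 'u::set_universe, 'v::comm_quantale) vccat \<Rightarrow> ('p, 'u, 'v) vccat
     \<Rightarrow> ('k, ('u, 'v) vcat, 'u) vcfun \<Rightarrow> ('k, 'p, 'u) vcfun \<Rightarrow> 'p \<Rightarrow> ('k \<Rightarrow> 'u) \<Rightarrow> bool" where
  "is_weighted_colimit K B W P C \<mu> \<longleftrightarrow>
     is_vcfun (vc_op K) VCat W \<and> is_vcfun K B P \<and> C \<in> Obj B \<and>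
     \<mu> \<in> nat_trans (vc_op K) VCat W (hom_along B P C) \<and>
     (\<forall>b\<in>Obj B.
        vcat_iso (Hom B C b) (nat_vcat (vc_op K) VCat W (hom_along B P b))
          (\<lambda>f. \<lambda>k\<in>Obj K.
             Comp VCat (FObj W k) (Hom B (FObj P k) C) (Hom B (FObj P k) b)
               (FMap (hom_from B (FObj P k)) C b f) (\<mu> k)))"

definition preserves_colimit ::
  "('k, 'u::set_universe, 'v::comm_quantale) vccat \<Rightarrow> ('p, 'u, 'v) vccat \<Rightarrow> ('q, 'u, 'v) vccat
     \<Rightarrow> ('p, 'q, 'u) vcfun \<Rightarrow> ('k, ('u, 'v) vcat, 'u) vcfun \<Rightarrow> ('k, 'p, 'u) vcfun \<Rightarrow> bool" where
  "preserves_colimit K B B' F W P \<longleftrightarrow> is_vcfun B B' F \<and>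
     (\<forall>C \<mu>. is_weighted_colimit K B W P C \<mu> \<longrightarrow>
        is_weighted_colimit K B' W (vcfun_comp F P) (FObj F C)
          (\<lambda>k\<in>Obj K. lam (ob (FObj W k)) (\<lambda>w. FMap F (FObj P k) C (app (\<mu> k) w))))"


section \<open>Density and density presentations\<close>

text \<open>
  \<open>L\<close>, with unit \<open>\<phi> : G \<rightarrow> L J\<close>, is the pointwise left Kan extension of \<open>G\<close> along \<open>J\<close>: each
  \<open>L b\<close> is the colimit \<open>B(J-,b) * G\<close>, with unit
  \<open>B(J-,b) \<rightarrow> C(L J-, L b) \<rightarrow> C(G-, L b)\<close> given by \<open>L\<close> followed by \<open>C(\<phi>, L b)\<close>.
\<close>

definition is_pointwise_lan ::
  "('o, 'u::set_universe, 'v::comm_quantale) vccat \<Rightarrow> ('p, 'u, 'v) vccat \<Rightarrow> ('q, 'u, 'v) vccat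
     \<Rightarrow> ('o, 'p, 'u) vcfun \<Rightarrow> ('o, 'q, 'u) vcfun \<Rightarrow> ('p, 'q, 'u) vcfun \<Rightarrow> ('o \<Rightarrow> 'u) \<Rightarrow> bool"
  where
  "is_pointwise_lan A B C J G L \<phi> \<longleftrightarrow>
     is_vcfun A B J \<and> is_vcfun A C G \<and> is_vcfun B C L \<and>
     \<phi> \<in> nat_trans A C G (vcfun_comp L J) \<and>
     (\<forall>b\<in>Obj B.
        is_weighted_colimit A C (hom_along B J b) G (FObj L b)
          (\<lambda>a\<in>Obj A. lam (ob (Hom B (FObj J a) b))
             (\<lambda>g. Comp C (FObj G a) (FObj L (FObj J a)) (FObj L b)
                    (FMap L (FObj J a) b g) (\<phi> a))))"

definition is_dense ::
  "('o, 'u::set_universe, 'v::comm_quantale) vccat \<Rightarrow> ('p, 'u, 'v) vccat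
     \<Rightarrow> ('o, 'p, 'u) vcfun \<Rightarrow> bool" where
  "is_dense A B J \<longleftrightarrow> is_pointwise_lan A B B J J vcfun_id (\<lambda>a\<in>Obj A. Id B (FObj J a))"

text \<open>
  The object sets of the full replete subcategories of \<open>B\<close> that contain the image of \<open>J\<close> and
  are closed under the given family of colimits.
\<close>

definition closed_subcats ::
  "('o, 'u::set_universe, 'v::comm_quantale) vccat \<Rightarrow> ('p, 'u, 'v) vccat
     \<Rightarrow> ('o, 'p, 'u) vcfun \<Rightarrow> 'i set \<Rightarrow> ('i \<Rightarrow> ('k, 'u, 'v) vccat)
     \<Rightarrow> ('i \<Rightarrow> ('k, ('u, 'v) vcat, 'u) vcfun) \<Rightarrow> ('i \<Rightarrow> ('k, 'p, 'u) vcfun) \<Rightarrow> 'p set set" where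
  "closed_subcats A B J \<Gamma> K W P =
     {S. S \<subseteq> Obj B \<and>
         (\<forall>b\<in>S. \<forall>c\<in>Obj B. iso_objects B b c \<longrightarrow> c \<in> S) \<and>
         (\<forall>a\<in>Obj A. FObj J a \<in> S) \<and>
         (\<forall>\<gamma>\<in>\<Gamma>. \<forall>C \<mu>. (\<forall>k\<in>Obj (K \<gamma>). FObj (P \<gamma>) k \<in> S) \<longrightarrow>
            is_weighted_colimit (K \<gamma>) B (W \<gamma>) (P \<gamma>) C \<mu> \<longrightarrow> C \<in> S)}"

definition density_presentation ::
  "('o, 'u::set_universe, 'v::comm_quantale) vccat \<Rightarrow> ('p, 'u, 'v) vccat
     \<Rightarrow> ('o, 'p, 'u) vcfun \<Rightarrow> 'i set \<Rightarrow> ('i \<Rightarrow> ('k, 'u, 'v) vccat)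
     \<Rightarrow> ('i \<Rightarrow> ('k, ('u, 'v) vcat, 'u) vcfun) \<Rightarrow> ('i \<Rightarrow> ('k, 'p, 'u) vcfun) \<Rightarrow> bool" where
  "density_presentation A B J \<Gamma> K W P \<longleftrightarrow>
     fully_faithful A B J \<and> is_dense A B J \<and>
     (\<forall>\<gamma>\<in>\<Gamma>. is_vcfun (vc_op (K \<gamma>)) VCat (W \<gamma>) \<and> is_vcfun (K \<gamma>) B (P \<gamma>) \<and>
        (\<exists>C \<mu>. is_weighted_colimit (K \<gamma>) B (W \<gamma>) (P \<gamma>) C \<mu>) \<and>
        (\<forall>a\<in>Obj A. preserves_colimit (K \<gamma>) B VCat (hom_from B (FObj J a)) (W \<gamma>) (P \<gamma>))) \<and>
     \<Inter> (closed_subcats A B J \<Gamma> K W P) = Obj B"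


section \<open>Sets as discrete V-categories, and the canonical diagrams\<close>

record ('o, 'u) ocat =
  OObj :: "'o set"
  OHom :: "'o \<Rightarrow> 'o \<Rightarrow> 'u set"
  OId :: "'o \<Rightarrow> 'u"
  OComp :: "'o \<Rightarrow> 'o \<Rightarrow> 'o \<Rightarrow> 'u \<Rightarrow> 'u \<Rightarrow> 'u"

text \<open>
  The free V-cat-category on an ordinary category: its homs, the coproducts of copies of the
  unit indexed by the ordinary homs, are discrete.
\<close>

definition free_vccat :: "('o, 'u::set_universe) ocat \<Rightarrow> ('o, 'u, 'v::comm_quantale) vccat" where
  "free_vccat C = \<lparr>Obj = OObj C, Hom = (\<lambda>a b. vdiscrete (OHom C a b)), Id = OId C,
     Comp = OComp C\<rparr>"

definition set_ocat :: "('u::set_universe, 'u) ocat" where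
  "set_ocat = \<lparr>OObj = UNIV,
     OHom = (\<lambda>S T. {lam (elts S) f | f. f ` elts S \<subseteq> elts T}),
     OId = (\<lambda>S. lam (elts S) (\<lambda>x. x)),
     OComp = (\<lambda>S T U g f. lam (elts S) (\<lambda>x. app g (app f x)))\<rparr>"

definition SetV :: "('u::set_universe, 'u, 'v::comm_quantale) vccat" where
  "SetV = free_vccat set_ocat"

text \<open>
  Maps \<open>S \<rightarrow> T\<close> and functors between the discrete categories on \<open>S\<close> and \<open>T\<close> are encoded by the
  same graphs.
\<close>

definition D_fun :: "('u::set_universe, ('u, 'v::comm_quantale) vcat, 'u) vcfun" where
  "D_fun = \<lparr>FObj = (\<lambda>S. vdiscrete (elts S)), FMap = (\<lambda>S T f. f)\<rparr>"

datatype 'v nob = Pt | Lev 'v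

text \<open>
  \<open>Pt\<close> is the extra object, \<open>Lev r\<close> the object \<open>r\<close>.  The arrows \<open>\<delta>\<^sub>0, \<delta>\<^sub>1 : r \<rightarrow> Pt\<close> are
  encoded by \<open>u0, u1\<close>, and every identity by \<open>u0\<close>.
\<close>

definition N_ocat :: "('v nob, 'u::set_universe) ocat" where
  "N_ocat = \<lparr>OObj = UNIV,
     OHom = (\<lambda>x y. if x = y then {u0} else if x \<noteq> Pt \<and> y = Pt then {u0, u1} else {}),
     OId = (\<lambda>x. u0),
     OComp = (\<lambda>x y z g f. if x = y then g else f)\<rparr>"

definition N_cat :: "('v nob, 'u::set_universe, 'v::comm_quantale) vccat" where
  "N_cat = free_vccat N_ocat"

text \<open>\<open>N\<close> is defined on the opposite category, where the \<open>\<delta>\<close>s point from \<open>Pt\<close> to \<open>Lev r\<close>.\<close>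

fun N_obj :: "'v nob \<Rightarrow> ('u::set_universe, 'v::comm_quantale) vcat" where
  "N_obj Pt = vunit"
| "N_obj (Lev r) = vtwo r"

definition N_weight :: "('v nob, ('u::set_universe, 'v::comm_quantale) vcat, 'u) vcfun" where
  "N_weight = \<lparr>FObj = N_obj,
     FMap = (\<lambda>x y i. if x = y then lam (ob (N_obj x :: ('u, 'v) vcat)) (\<lambda>z. z)
                     else lam {u0} (\<lambda>z. i))\<rparr>"

fun F_obj :: "('u::set_universe, 'v::comm_quantale) vcat \<Rightarrow> 'v nob \<Rightarrow> 'u" where
  "F_obj X Pt = mk (ob X)"
| "F_obj X (Lev r) = mk {pair x' x | x' x. x' \<in> ob X \<and> x \<in> ob X \<and> r \<le> dist X x' x}"

definition F_fun ::
  "('u::set_universe, 'v::comm_quantale) vcat \<Rightarrow> ('v nob, 'u, 'u) vcfun" where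
  "F_fun X = \<lparr>FObj = F_obj X,
     FMap = (\<lambda>x y i. lam (elts (F_obj X x))
               (if x = y then (\<lambda>z. z) else if i = u0 then pfst else psnd))\<rparr>"

end

theory Submission
  imports Defs
begin

text \<open>
  Density: the one-element set already represents the objects and distances of a V-category, so
  a transformation \<open>[D-,X] \<rightarrow> [D-,Y]\<close> is postcomposition with a functor read off at that set.

  A cocone on \<open>(N, DF\<^sub>X)\<close> with vertex \<open>B\<close> is a map \<open>f\<close> from the objects of \<open>X\<close> to those of \<open>B\<close> with
  \<open>r \<le> B(fx',fx)\<close> whenever \<open>r \<le> X(x',x)\<close>, that is, a functor \<open>X \<rightarrow> B\<close>; hence \<open>N * DF\<^sub>X = X\<close>, which
  gives the closure condition at once.  If \<open>V\<close> is integral, \<open>[DS,DT]\<close> is discrete on the set of maps,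
  and a map from \<open>S\<close> to the pairs at distance at least \<open>r\<close> is a pair of maps at distance at least
  \<open>r\<close>; so \<open>[DS,-]\<close> carries the diagram of \<open>X\<close> to that of \<open>[DS,X]\<close>, and the colimit is preserved.
\<close>

section \<open>Small sets\<close>

text \<open>The obstacle is that preservation is demanded for every colimit of the diagram, not for
  one chosen model. Uniqueness of colimits therefore turns an arbitrary colimit cocone into a
  bijective isometry from \<open>X\<close> to the vertex \<open>C\<close>. Both the canonical
  colimit and its image under \<open>[DS,-]\<close> are then tested by one criterion,
  \<open>N_colimitI\<close>, for diagrams of discrete V-categories: the cocone is bijective at
  \<open>Pt\<close>, and every pair \<open>x'\<close>, \<open>x\<close> of the vertex comes from an
  element at the level \<open>C(x',x)\<close>. This explains the shape of \<open>N\<close>, with one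
  object for each element of the quantale: the exact distance of a pair is itself used as a level.
  The criterion rests on a Yoneda argument. The objects of the weight at \<open>k\<close> are the
  arrows \<open>k \<rightarrow> Pt\<close>, so a cocone amounts to one arrow out of
  \<open>P Pt\<close>; the distance \<open>r\<close> in \<open>vtwo r\<close> adds the condition
  that the two composites of this arrow with the arrows coming from level \<open>r\<close> lie at
  distance at least \<open>r\<close>.\<close>

lemma small_elts [simp]: "small (elts x)"
  by (auto simp: small_def)

lemma elts_mk [simp]: "small A \<Longrightarrow> elts (mk A) = A"
  unfolding small_def mk_def by (elim exE) (rule theI, assumption, rule extensionality, simp)

lemma small_subset: "small A \<Longrightarrow> B \<subseteq> A \<Longrightarrow> small B"
  unfolding small_def by (auto intro: separation)

lemma small_empty [simp]: "small {}"
  by (rule small_subset[OF small_elts empty_subsetI])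

lemma small_doubleton [simp]: "small {x, y}"
  unfolding small_def by (rule pairing)

lemma small_singleton [simp]: "small {x}"
  using small_doubleton[of x x] by simp

lemma small_image [simp]: "small A \<Longrightarrow> small (f ` A)" for f :: "'u::set_universe \<Rightarrow> 'u"
  unfolding small_def by (auto simp: replacement)

lemma small_UN:
  fixes F :: "'u::set_universe \<Rightarrow> 'u set"
  assumes "small A" "\<And>a. a \<in> A \<Longrightarrow> small (F a)"
  shows "small (\<Union>a\<in>A. F a)"
proof -
  \<comment> \<open>Replacement applies to maps from the universe to itself, so each member of the
    family is first coded by \<open>mk\<close>.\<close>
  let ?x = "mk ((\<lambda>a. mk (F a)) ` A)"
  obtain z where z: "elts z = (\<Union>y\<in>elts ?x. elts y)"
    using union by blast
  have "elts z = (\<Union>a\<in>A. F a)"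
    using assms by (simp add: z)
  then show ?thesis
    unfolding small_def by blast
qed

lemma small_subsets:
  assumes "small A"
  shows "small {y. elts y \<subseteq> A}"
  using assms powerset unfolding small_def by auto

lemma mk_eq_iff: "small A \<Longrightarrow> small B \<Longrightarrow> mk A = mk B \<longleftrightarrow> A = B"
  by (metis elts_mk)

lemma pair_eq_iff [simp]: "pair a b = pair c d \<longleftrightarrow> a = c \<and> b = d"
  unfolding pair_def by (auto simp: mk_eq_iff doubleton_eq_iff)

lemma pfst_pair [simp]: "pfst (pair a b) = a"
  unfolding pfst_def by auto

lemma psnd_pair [simp]: "psnd (pair a b) = b"
  unfolding psnd_def by auto

lemma small_pairs:
  assumes "small A" "small B"
  shows "small {pair a b | a b. a \<in> A \<and> b \<in> B}"
proof -
  have "{pair a b | a b. a \<in> A \<and> b \<in> B} = (\<Union>a\<in>A. pair a ` B)"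
    by auto
  then show ?thesis
    using assms by (simp add: small_UN)
qed

lemma u0_neq_u1 [simp]: "u0 \<noteq> u1" "u1 \<noteq> u0"
  unfolding u1_def u0_def by (auto simp: mk_eq_iff)

lemma elts_lam: "small A \<Longrightarrow> elts (lam A f) = (\<lambda>x. pair x (f x)) ` A"
  unfolding lam_def by simp

lemma app_lam [simp]: "small A \<Longrightarrow> x \<in> A \<Longrightarrow> app (lam A f) x = f x"
  unfolding app_def by (auto simp: elts_lam)

lemma lam_cong: "A = B \<Longrightarrow> (\<And>x. x \<in> B \<Longrightarrow> f x = g x) \<Longrightarrow> lam A f = lam B g"
  unfolding lam_def by (simp cong: image_cong)

lemma lam_eq_iff: "small A \<Longrightarrow> lam A f = lam A g \<longleftrightarrow> (\<forall>x\<in>A. f x = g x)"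
  by (metis app_lam lam_cong)

text \<open>A graph is a set of pairs, so all these graphs lie in the power set of the
  product.\<close>

lemma small_maps:
  assumes "small A" "small B"
  shows "small {lam A f | f. f ` A \<subseteq> B}"
proof (rule small_subset)
  show "small {y. elts y \<subseteq> {pair a b | a b. a \<in> A \<and> b \<in> B}}"
    using assms by (intro small_subsets small_pairs)
  show "{lam A f | f. f ` A \<subseteq> B} \<subseteq> {y. elts y \<subseteq> {pair a b | a b. a \<in> A \<and> b \<in> B}}"
    using assms by (fastforce simp: elts_lam)
qed


section \<open>Quantales and V-categories\<close>

text \<open>Monotonicity is not an axiom of the class. It comes from the unit
  \<open>y \<le> ihom z (y * z)\<close> of the adjunction.\<close>

lemma quantale_mult_mono:
  fixes a b c d :: "'v::comm_quantale"
  assumes "a \<le> b" "c \<le> d"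
  shows "a * c \<le> b * d"
proof -
  have mono: "x * z \<le> y * z" if "x \<le> y" for x y z :: 'v
  proof -
    have "y \<le> ihom z (y * z)"
      using adjunction[of y z "y * z"] by simp
    with that have "x \<le> ihom z (y * z)"
      by (rule order_trans)
    then show ?thesis
      by (simp add: adjunction)
  qed
  have "a * c \<le> b * c"
    using assms mono by simp
  also have "\<dots> \<le> b * d"
    using mono[of c d b] assms by (simp add: mult.commute)
  finally show ?thesis .
qed

text \<open>A left adjoint preserves the least element.\<close>

lemma bot_mult [simp]: "bot * (a::'v::comm_quantale) = bot"
  using adjunction[of bot a bot] by (simp add: bot_unique)

lemma mult_bot [simp]: "(a::'v::comm_quantale) * bot = bot"
  by (simp add: mult.commute[of a])

section \<open>V-categories, V-functors and isomorphisms\<close>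

lemma is_vcat_refl: "is_vcat X \<Longrightarrow> x \<in> ob X \<Longrightarrow> 1 \<le> dist X x x"
  by (simp add: is_vcat_def)

lemma is_vcat_trans:
  "is_vcat X \<Longrightarrow> x \<in> ob X \<Longrightarrow> x' \<in> ob X \<Longrightarrow> x'' \<in> ob X \<Longrightarrow>
    dist X x' x * dist X x'' x' \<le> dist X x'' x"
  by (simp add: is_vcat_def)

lemma is_vcat_trans':
  "is_vcat X \<Longrightarrow> x \<in> ob X \<Longrightarrow> x' \<in> ob X \<Longrightarrow> x'' \<in> ob X \<Longrightarrow>
    dist X x'' x' * dist X x' x \<le> dist X x'' x"
  by (subst mult.commute) (rule is_vcat_trans)

lemma small_vcat_is_vcat: "small_vcat X \<Longrightarrow> is_vcat X"
  by (simp add: small_vcat_def)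

lemma small_vcat_small [simp]: "small_vcat X \<Longrightarrow> small (ob X)"
  by (simp add: small_vcat_def)

lemma vfunctorI:
  assumes "\<And>x. x \<in> ob X \<Longrightarrow> f x \<in> ob Y"
    and "\<And>x' x. x' \<in> ob X \<Longrightarrow> x \<in> ob X \<Longrightarrow> dist X x' x \<le> dist Y (f x') (f x)"
  shows "vfunctor X Y f"
  using assms by (simp add: vfunctor_def)

lemma vfunctor_ob: "vfunctor X Y f \<Longrightarrow> x \<in> ob X \<Longrightarrow> f x \<in> ob Y"
  by (simp add: vfunctor_def)

lemma vfunctor_dist:
  "vfunctor X Y f \<Longrightarrow> x' \<in> ob X \<Longrightarrow> x \<in> ob X \<Longrightarrow> dist X x' x \<le> dist Y (f x') (f x)"
  by (simp add: vfunctor_def)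

lemma vfunctor_cong:
  "vfunctor X Y f \<Longrightarrow> (\<And>x. x \<in> ob X \<Longrightarrow> f x = g x) \<Longrightarrow> vfunctor X Y g"
  by (simp add: vfunctor_def)

lemma vfunctor_comp: "vfunctor X Y f \<Longrightarrow> vfunctor Y Z g \<Longrightarrow> vfunctor X Z (\<lambda>x. g (f x))"
  unfolding vfunctor_def by (meson order_trans)

text \<open>The inverse functor supplies the reverse inequality between distances. The isomorphisms
  in the colimit conditions are proved in this form.\<close>

lemma vcat_iso_iff:
  "vcat_iso X Y f \<longleftrightarrow> bij_betw f (ob X) (ob Y) \<and>
     (\<forall>x'\<in>ob X. \<forall>x\<in>ob X. dist X x' x = dist Y (f x') (f x))" (is "_ \<longleftrightarrow> ?R")
proof
  assume "vcat_iso X Y f"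
  then obtain g where f: "vfunctor X Y f" and g: "vfunctor Y X g"
    and gf: "\<And>x. x \<in> ob X \<Longrightarrow> g (f x) = x" and fg: "\<And>y. y \<in> ob Y \<Longrightarrow> f (g y) = y"
    unfolding vcat_iso_def by blast
  have "bij_betw f (ob X) (ob Y)"
    using f g gf fg by (intro bij_betw_byWitness[where f' = g]) (auto simp: vfunctor_def)
  moreover have "dist X x' x = dist Y (f x') (f x)" if "x' \<in> ob X" "x \<in> ob X" for x' x
  proof (rule antisym)
    show "dist X x' x \<le> dist Y (f x') (f x)"
      using f that by (rule vfunctor_dist)
    show "dist Y (f x') (f x) \<le> dist X x' x"
      using vfunctor_dist[OF g, of "f x'" "f x"] that f by (simp add: gf vfunctor_ob)
  qed
  ultimately show ?R
    by blast
next
  assume R: ?R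
  let ?g = "inv_into (ob X) f"
  have g: "?g y \<in> ob X" "f (?g y) = y" if "y \<in> ob Y" for y
    using R that by (auto simp: bij_betw_def f_inv_into_f inv_into_into)
  have "?g (f x) = x" if "x \<in> ob X" for x
    using R that by (auto simp: bij_betw_def)
  moreover have "vfunctor X Y f"
    using R by (auto simp: vfunctor_def bij_betwE)
  moreover have "vfunctor Y X ?g"
    using R g by (auto simp: vfunctor_def)
  ultimately show "vcat_iso X Y f"
    unfolding vcat_iso_def using g by blast
qed

section \<open>Discrete V-categories, tensor products, \<open>vunit\<close> and
  \<open>vtwo\<close>\<close>

lemma ob_vdiscrete [simp]: "ob (vdiscrete A) = A"
  by (simp add: vdiscrete_def)

lemma dist_vdiscrete:
  "dist (vdiscrete A) x y = (if x \<in> A \<and> x = y then 1 else bot)"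
  by (simp add: vdiscrete_def)

lemma small_vcat_vdiscrete [simp]: "small A \<Longrightarrow> small_vcat (vdiscrete A)"
  by (auto simp: small_vcat_def is_vcat_def dist_vdiscrete)

text \<open>The distances of a discrete V-category are \<open>1\<close> and \<open>bot\<close>;
  reflexivity of \<open>Y\<close> takes care of \<open>1\<close>.\<close>

lemma vfunctor_vdiscrete:
  assumes "is_vcat Y" "\<And>x. x \<in> A \<Longrightarrow> f x \<in> ob Y"
  shows "vfunctor (vdiscrete A) Y f"
  using assms by (auto simp: vfunctor_def dist_vdiscrete is_vcat_refl)

lemma ob_vtensor [simp]: "ob (vtensor X Y) = ob X \<times> ob Y"
  by (simp add: vtensor_def)

lemma dist_vtensor [simp]: "dist (vtensor X Y) (x', y') (x, y) = dist X x' x * dist Y y' y"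
  by (simp add: vtensor_def)

lemma ob_vunit [simp]: "ob vunit = {u0}"
  by (simp add: vunit_def)

lemma ob_vtwo [simp]: "ob (vtwo r) = {u0, u1}"
  by (simp add: vtwo_def)

lemma dist_vtwo:
  "dist (vtwo r) x y = (if x \<in> {u0, u1} \<and> x = y then 1
                   else if x = u0 \<and> y = u1 then r else bot)"
  by (simp add: vtwo_def)

lemma small_vcat_vunit [simp]: "small_vcat vunit"
  by (simp add: vunit_def)

lemma small_vcat_vtwo [simp]: "small_vcat (vtwo r)"
  by (auto simp: small_vcat_def is_vcat_def dist_vtwo)


section \<open>The V-cat-category of small V-categories\<close>

lemma in_ob_vhom:
  "f \<in> ob (vhom Y Z) \<longleftrightarrow> (\<exists>h. f = lam (ob Y) h \<and> vfunctor Y Z h)"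
  by (auto simp: vhom_def Let_def)

lemma vhom_lam: "vfunctor Y Z h \<Longrightarrow> lam (ob Y) h \<in> ob (vhom Y Z)"
  by (auto simp: in_ob_vhom)

lemma vhom_vfunctor: "small (ob Y) \<Longrightarrow> f \<in> ob (vhom Y Z) \<Longrightarrow> vfunctor Y Z (app f)"
  unfolding in_ob_vhom by (auto intro: vfunctor_cong)

lemma vhom_eta: "small (ob Y) \<Longrightarrow> f \<in> ob (vhom Y Z) \<Longrightarrow> lam (ob Y) (app f) = f"
  unfolding in_ob_vhom by (auto simp: lam_eq_iff)

lemma vhom_app: "small (ob Y) \<Longrightarrow> f \<in> ob (vhom Y Z) \<Longrightarrow> y \<in> ob Y \<Longrightarrow> app f y \<in> ob Z"
  using vhom_vfunctor vfunctor_ob by metis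

lemma vhom_ext:
  assumes "small (ob Y)" "f \<in> ob (vhom Y Z)" "g \<in> ob (vhom Y Z)"
    and "\<And>y. y \<in> ob Y \<Longrightarrow> app f y = app g y"
  shows "f = g"
  using assms vhom_eta by (metis lam_cong)

lemma dist_vhom:
  "f \<in> ob (vhom Y Z) \<Longrightarrow> g \<in> ob (vhom Y Z) \<Longrightarrow>
    dist (vhom Y Z) f g = (INF y\<in>ob Y. dist Z (app f y) (app g y))"
  by (simp add: vhom_def Let_def)

lemma dist_vhom_le:
  "f \<in> ob (vhom Y Z) \<Longrightarrow> g \<in> ob (vhom Y Z) \<Longrightarrow> y \<in> ob Y \<Longrightarrow>
    dist (vhom Y Z) f g \<le> dist Z (app f y) (app g y)"
  by (subst dist_vhom) (auto intro: INF_lower)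

lemma small_vcat_vhom [simp]:
  assumes Y: "small_vcat Y" and Z: "small_vcat Z"
  shows "small_vcat (vhom Y Z)"
  unfolding small_vcat_def is_vcat_def
proof (intro conjI ballI allI impI)
  note app = vhom_app[OF small_vcat_small[OF Y], of _ Z]
  note Zv = small_vcat_is_vcat[OF Z]
  show "small (ob (vhom Y Z))"
    by (rule small_subset[OF small_maps[of "ob Y" "ob Z"]])
      (use assms in \<open>auto simp: in_ob_vhom vfunctor_def image_subset_iff\<close>)
  show "1 \<le> dist (vhom Y Z) f f" if "f \<in> ob (vhom Y Z)" for f
    using that by (auto simp: dist_vhom intro!: INF_greatest is_vcat_refl[OF Zv] app)
  show "dist (vhom Y Z) g f * dist (vhom Y Z) h g \<le> dist (vhom Y Z) h f"
    if "f \<in> ob (vhom Y Z)" "g \<in> ob (vhom Y Z)" "h \<in> ob (vhom Y Z)" for f g h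
    unfolding dist_vhom[OF that(3,1)]
  proof (rule INF_greatest)
    fix y assume y: "y \<in> ob Y"
    have "dist (vhom Y Z) g f * dist (vhom Y Z) h g
        \<le> dist Z (app g y) (app f y) * dist Z (app h y) (app g y)"
      using that y by (intro quantale_mult_mono dist_vhom_le)
    also have "\<dots> \<le> dist Z (app h y) (app f y)"
      using that y by (intro is_vcat_trans[OF Zv] app)
    finally show "dist (vhom Y Z) g f * dist (vhom Y Z) h g \<le> dist Z (app h y) (app f y)" .
  qed
  show "dist (vhom Y Z) f g = bot" if "\<not> (f \<in> ob (vhom Y Z) \<and> g \<in> ob (vhom Y Z))" for f g
    using that by (auto simp: vhom_def Let_def)
qed

lemma VCat_simps [simp]:
  "Obj VCat = {X. small_vcat X}"
  "Hom VCat = vhom"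
  "Id VCat X = lam (ob X) (\<lambda>x. x)"
  "Comp VCat X Y Z g f = lam (ob X) (\<lambda>x. app g (app f x))"
  by (simp_all add: VCat_def)

lemma vhom_id: "lam (ob X) (\<lambda>x. x) \<in> ob (vhom X X)"
  by (rule vhom_lam) (simp add: vfunctor_def)

lemma vhom_id_left:
  assumes "small_vcat X" "small_vcat Y" "f \<in> ob (vhom X Y)"
  shows "lam (ob X) (\<lambda>x. app (lam (ob Y) (\<lambda>y. y)) (app f x)) = f"
proof -
  have "lam (ob X) (\<lambda>x. app (lam (ob Y) (\<lambda>y. y)) (app f x)) = lam (ob X) (app f)"
    using assms vhom_app[of X f Y] by (auto simp: lam_eq_iff)
  then show ?thesis
    using assms by (simp add: vhom_eta)
qed

lemma vhom_assoc:
  assumes "small_vcat X" "small_vcat Y" "f \<in> ob (vhom X Y)"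
  shows "lam (ob X) (\<lambda>x. app (lam (ob Y) (\<lambda>y. app h (app g y))) (app f x)) =
    lam (ob X) (\<lambda>x. app h (app (lam (ob X) (\<lambda>x. app g (app f x))) x))"
  using assms vhom_app[of X f Y] by (auto simp: lam_eq_iff)

lemma vhom_comp:
  assumes "small_vcat X" "small_vcat Y" "f \<in> ob (vhom X Y)" "g \<in> ob (vhom Y Z)"
  shows "lam (ob X) (\<lambda>x. app g (app f x)) \<in> ob (vhom X Z)"
  using assms by (intro vhom_lam vfunctor_comp[of X Y _ Z] vhom_vfunctor) auto

lemma is_vccat_VCat [simp]:
  "is_vccat (VCat :: (('u::set_universe, 'v::comm_quantale) vcat, 'u, 'v) vccat)"
  unfolding is_vccat_def VCat_simps mem_Collect_eq
proof (intro conjI ballI)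
  fix X Y Z W :: "('u, 'v) vcat"
  assume XYZ: "X \<in> {X. small_vcat X}" "Y \<in> {X. small_vcat X}" "Z \<in> {X. small_vcat X}"
  then have X: "small_vcat X" and Y: "small_vcat Y" and Z: "small_vcat Z"
    by auto
  note app1 = vhom_app[OF small_vcat_small[OF X], of _ Y]
  note app2 = vhom_app[OF small_vcat_small[OF Y], of _ Z]
  show "vfunctor (vtensor (vhom Y Z) (vhom X Y)) (vhom X Z)
      (\<lambda>(g, f). lam (ob X) (\<lambda>x. app g (app f x)))"
  proof (rule vfunctorI; clarsimp)
    fix g f assume "g \<in> ob (vhom Y Z)" "f \<in> ob (vhom X Y)"
    then show "lam (ob X) (\<lambda>x. app g (app f x)) \<in> ob (vhom X Z)"
      using X Y by (intro vhom_comp)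
  next
    fix g' f' g f
    assume g': "g' \<in> ob (vhom Y Z)" and f': "f' \<in> ob (vhom X Y)"
      and g: "g \<in> ob (vhom Y Z)" and f: "f \<in> ob (vhom X Y)"
    show "dist (vhom Y Z) g' g * dist (vhom X Y) f' f
      \<le> dist (vhom X Z) (lam (ob X) (\<lambda>x. app g' (app f' x))) (lam (ob X) (\<lambda>x. app g (app f x)))"
      unfolding dist_vhom[OF vhom_comp[OF X Y f' g'] vhom_comp[OF X Y f g]]
    proof (rule INF_greatest)
      fix x assume x: "x \<in> ob X"
      \<comment> \<open>The triangle in \<open>Z\<close> leads from \<open>g' (f' x)\<close> through
        \<open>g (f' x)\<close> to \<open>g (f x)\<close>; its second side is bounded by
        V-functoriality of \<open>g\<close>.\<close>
      have "dist (vhom Y Z) g' g * dist (vhom X Y) f' f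
          \<le> dist Z (app g' (app f' x)) (app g (app f' x)) * dist Y (app f' x) (app f x)"
        using f f' g g' x by (intro quantale_mult_mono dist_vhom_le app1)
      also have "\<dots> \<le> dist Z (app g' (app f' x)) (app g (app f' x))
          * dist Z (app g (app f' x)) (app g (app f x))"
        using f f' g x Y by (intro quantale_mult_mono vfunctor_dist[OF vhom_vfunctor] app1) auto
      also have "\<dots> \<le> dist Z (app g' (app f' x)) (app g (app f x))"
        using f f' g g' x by (intro is_vcat_trans'[OF small_vcat_is_vcat[OF Z]] app1 app2)
      finally show "dist (vhom Y Z) g' g * dist (vhom X Y) f' f
        \<le> dist Z (app (lam (ob X) (\<lambda>x. app g' (app f' x))) x)
            (app (lam (ob X) (\<lambda>x. app g (app f x))) x)"
        using x X by simp
    qed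
  qed
next
  fix X Y :: "('u, 'v) vcat" and f
  assume "X \<in> {X. small_vcat X}" "Y \<in> {X. small_vcat X}" "f \<in> ob (vhom X Y)"
  then show "lam (ob X) (\<lambda>x. app f (app (lam (ob X) (\<lambda>x. x)) x)) = f"
    by (auto simp: vhom_eta cong: lam_cong)
qed (auto simp: vhom_id vhom_id_left vhom_eta vhom_assoc)


section \<open>Functors between V-cat-categories\<close>

lemma is_vccat_hom: "is_vccat A \<Longrightarrow> a \<in> Obj A \<Longrightarrow> b \<in> Obj A \<Longrightarrow> small_vcat (Hom A a b)"
  by (simp add: is_vccat_def)

lemma is_vccat_id: "is_vccat A \<Longrightarrow> a \<in> Obj A \<Longrightarrow> Id A a \<in> ob (Hom A a a)"
  by (simp add: is_vccat_def)

lemma is_vccat_vfunctor: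
  "is_vccat A \<Longrightarrow> a \<in> Obj A \<Longrightarrow> b \<in> Obj A \<Longrightarrow> c \<in> Obj A \<Longrightarrow>
    vfunctor (vtensor (Hom A b c) (Hom A a b)) (Hom A a c) (\<lambda>(g, f). Comp A a b c g f)"
  by (simp add: is_vccat_def)

lemma is_vccat_comp:
  "is_vccat A \<Longrightarrow> a \<in> Obj A \<Longrightarrow> b \<in> Obj A \<Longrightarrow> c \<in> Obj A \<Longrightarrow>
    f \<in> ob (Hom A a b) \<Longrightarrow> g \<in> ob (Hom A b c) \<Longrightarrow> Comp A a b c g f \<in> ob (Hom A a c)"
  using vfunctor_ob[OF is_vccat_vfunctor, of A a b c "(g, f)"] by simp

lemma is_vccat_comp_dist:
  assumes "is_vccat A" "a \<in> Obj A" "b \<in> Obj A" "c \<in> Obj A"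
    "f' \<in> ob (Hom A a b)" "f \<in> ob (Hom A a b)" "g' \<in> ob (Hom A b c)" "g \<in> ob (Hom A b c)"
  shows "dist (Hom A b c) g' g * dist (Hom A a b) f' f
    \<le> dist (Hom A a c) (Comp A a b c g' f') (Comp A a b c g f)"
  using vfunctor_dist[OF is_vccat_vfunctor, of A a b c "(g', f')" "(g, f)"] assms by simp

text \<open>By reflexivity \<open>1\<close> lies below the self-distance of \<open>g\<close>, so
  tensoring with that self-distance does not decrease the distance of \<open>f'\<close> and
  \<open>f\<close>.\<close>

lemma is_vccat_whisker_left:
  assumes "is_vccat A" "a \<in> Obj A" "b \<in> Obj A" "c \<in> Obj A"
    "f' \<in> ob (Hom A a b)" "f \<in> ob (Hom A a b)" "g \<in> ob (Hom A b c)"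
  shows "dist (Hom A a b) f' f \<le> dist (Hom A a c) (Comp A a b c g f') (Comp A a b c g f)"
proof -
  have "1 * dist (Hom A a b) f' f \<le> dist (Hom A b c) g g * dist (Hom A a b) f' f"
    using assms by (intro quantale_mult_mono is_vcat_refl small_vcat_is_vcat is_vccat_hom) auto
  then show ?thesis
    using is_vccat_comp_dist[OF assms(1-6,7,7)] by simp
qed

lemma is_vccat_whisker_right:
  assumes "is_vccat A" "a \<in> Obj A" "b \<in> Obj A" "c \<in> Obj A"
    "f \<in> ob (Hom A a b)" "g' \<in> ob (Hom A b c)" "g \<in> ob (Hom A b c)"
  shows "dist (Hom A b c) g' g \<le> dist (Hom A a c) (Comp A a b c g' f) (Comp A a b c g f)"
proof -
  have "dist (Hom A b c) g' g * 1 \<le> dist (Hom A b c) g' g * dist (Hom A a b) f f"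
    using assms by (intro quantale_mult_mono is_vcat_refl small_vcat_is_vcat is_vccat_hom) auto
  then show ?thesis
    using is_vccat_comp_dist[OF assms(1-4,5,5,6,7)] by simp
qed

lemma is_vccat_id_left:
  "is_vccat A \<Longrightarrow> a \<in> Obj A \<Longrightarrow> b \<in> Obj A \<Longrightarrow> f \<in> ob (Hom A a b) \<Longrightarrow>
    Comp A a b b (Id A b) f = f"
  by (simp add: is_vccat_def)

lemma is_vccat_id_right:
  "is_vccat A \<Longrightarrow> a \<in> Obj A \<Longrightarrow> b \<in> Obj A \<Longrightarrow> f \<in> ob (Hom A a b) \<Longrightarrow>
    Comp A a a b f (Id A a) = f"
  by (simp add: is_vccat_def)

lemma is_vccat_assoc:
  "is_vccat A \<Longrightarrow> a \<in> Obj A \<Longrightarrow> b \<in> Obj A \<Longrightarrow> c \<in> Obj A \<Longrightarrow> d \<in> Obj A \<Longrightarrow>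
    f \<in> ob (Hom A a b) \<Longrightarrow> g \<in> ob (Hom A b c) \<Longrightarrow> h \<in> ob (Hom A c d) \<Longrightarrow>
    Comp A a b d (Comp A b c d h g) f = Comp A a c d h (Comp A a b c g f)"
  by (simp add: is_vccat_def)

section \<open>Opposites, composites and representable functors\<close>

lemma vc_op_simps [simp]:
  "Obj (vc_op A) = Obj A"
  "Hom (vc_op A) a b = Hom A b a"
  "Id (vc_op A) = Id A"
  "Comp (vc_op A) a b c g f = Comp A c b a f g"
  by (simp_all add: vc_op_def)

text \<open>Reversed composition swaps the two tensor factors, so its V-functoriality uses
  commutativity of the quantale.\<close>

lemma is_vccat_vc_op [simp]:
  assumes A: "is_vccat A"
  shows "is_vccat (vc_op A)"
  unfolding is_vccat_def vc_op_simps
proof (intro conjI ballI)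
  fix a b c assume abc: "a \<in> Obj A" "b \<in> Obj A" "c \<in> Obj A"
  show "vfunctor (vtensor (Hom A c b) (Hom A b a)) (Hom A c a) (\<lambda>(g, f). Comp A c b a f g)"
  proof (rule vfunctorI; clarsimp)
    show "Comp A c b a f g \<in> ob (Hom A c a)" if "g \<in> ob (Hom A c b)" "f \<in> ob (Hom A b a)" for g f
      using that A abc by (intro is_vccat_comp)
    show "dist (Hom A c b) g' g * dist (Hom A b a) f' f
        \<le> dist (Hom A c a) (Comp A c b a f' g') (Comp A c b a f g)"
      if "g' \<in> ob (Hom A c b)" "f' \<in> ob (Hom A b a)" "g \<in> ob (Hom A c b)" "f \<in> ob (Hom A b a)"
      for g' f' g f
      using is_vccat_comp_dist[OF A, of c b a g' g f' f] that abc by (simp add: mult.commute)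
  qed
qed (use A in \<open>simp_all add: is_vccat_hom is_vccat_id is_vccat_id_left is_vccat_id_right is_vccat_assoc\<close>)

lemma is_vcfun_cod: "is_vcfun A B F \<Longrightarrow> is_vccat B"
  and is_vcfun_FObj: "is_vcfun A B F \<Longrightarrow> a \<in> Obj A \<Longrightarrow> FObj F a \<in> Obj B"
  and is_vcfun_vfunctor: "is_vcfun A B F \<Longrightarrow> a \<in> Obj A \<Longrightarrow> b \<in> Obj A \<Longrightarrow>
    vfunctor (Hom A a b) (Hom B (FObj F a) (FObj F b)) (FMap F a b)"
  and is_vcfun_Id: "is_vcfun A B F \<Longrightarrow> a \<in> Obj A \<Longrightarrow> FMap F a a (Id A a) = Id B (FObj F a)"
  and is_vcfun_Comp: "is_vcfun A B F \<Longrightarrow> a \<in> Obj A \<Longrightarrow> b \<in> Obj A \<Longrightarrow> c \<in> Obj A \<Longrightarrow>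
    f \<in> ob (Hom A a b) \<Longrightarrow> g \<in> ob (Hom A b c) \<Longrightarrow> FMap F a c (Comp A a b c g f) =
      Comp B (FObj F a) (FObj F b) (FObj F c) (FMap F b c g) (FMap F a b f)"
  by (simp_all add: is_vcfun_def)

lemma is_vcfun_FMap:
  "is_vcfun A B F \<Longrightarrow> a \<in> Obj A \<Longrightarrow> b \<in> Obj A \<Longrightarrow> f \<in> ob (Hom A a b) \<Longrightarrow>
    FMap F a b f \<in> ob (Hom B (FObj F a) (FObj F b))"
  using is_vcfun_vfunctor vfunctor_ob by metis

lemma vcfun_id_simps [simp]: "FObj vcfun_id a = a" "FMap vcfun_id a b f = f"
  by (simp_all add: vcfun_id_def)

lemma vcfun_comp_simps [simp]:
  "FObj (vcfun_comp G F) a = FObj G (FObj F a)"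
  "FMap (vcfun_comp G F) a b f = FMap G (FObj F a) (FObj F b) (FMap F a b f)"
  by (simp_all add: vcfun_comp_def)

lemma vcfun_op_simps [simp]: "FObj (vcfun_op F) = FObj F" "FMap (vcfun_op F) a b = FMap F b a"
  by (simp_all add: vcfun_op_def)

lemma hom_to_simps [simp]:
  "FObj (hom_to B c) b = Hom B b c"
  "FMap (hom_to B c) b b' f = lam (ob (Hom B b c)) (\<lambda>g. Comp B b' b c g f)"
  by (simp_all add: hom_to_def)

lemma hom_from_simps [simp]:
  "FObj (hom_from B a) b = Hom B a b"
  "FMap (hom_from B a) b b' f = lam (ob (Hom B a b)) (\<lambda>g. Comp B a b b' f g)"
  by (simp_all add: hom_from_def)

lemma hom_along_simps [simp]:
  "FObj (hom_along B P c) k = Hom B (FObj P k) c"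
  "FMap (hom_along B P c) k k' f =
    lam (ob (Hom B (FObj P k) c)) (\<lambda>g. Comp B (FObj P k') (FObj P k) c g (FMap P k' k f))"
  by (simp_all add: hom_along_def)

lemma is_vcfun_id: "is_vccat A \<Longrightarrow> is_vcfun A A vcfun_id"
  by (simp add: is_vcfun_def vfunctor_def)

lemma is_vcfun_comp:
  assumes F: "is_vcfun A B F" and G: "is_vcfun B C G"
  shows "is_vcfun A C (vcfun_comp G F)"
  unfolding is_vcfun_def
proof (intro conjI ballI)
  show "is_vccat A" "is_vccat C"
    using F G by (auto simp: is_vcfun_def)
  fix a b assume ab: "a \<in> Obj A" "b \<in> Obj A"
  show "vfunctor (Hom A a b) (Hom C (FObj (vcfun_comp G F) a) (FObj (vcfun_comp G F) b))
     (FMap (vcfun_comp G F) a b)"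
    using vfunctor_comp[OF is_vcfun_vfunctor[OF F ab] is_vcfun_vfunctor[OF G, of "FObj F a" "FObj F b"]]
      ab F by (simp add: is_vcfun_FObj vcfun_comp_def)
qed (use F G in \<open>simp_all add: is_vcfun_FObj is_vcfun_Id is_vcfun_Comp is_vcfun_FMap\<close>)

lemma is_vcfun_op: "is_vcfun A B F \<Longrightarrow> is_vcfun (vc_op A) (vc_op B) (vcfun_op F)"
  by (auto simp: is_vcfun_def)

lemma is_vcfun_hom_from:
  assumes B: "is_vccat B" and a: "a \<in> Obj B"
  shows "is_vcfun B VCat (hom_from B a)"
  unfolding is_vcfun_def
proof (intro conjI ballI)
  fix b c d assume b: "b \<in> Obj B" and c: "c \<in> Obj B" and d: "d \<in> Obj B"
  have small: "small (ob (Hom B a b))"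
    using B a b by (simp add: is_vccat_hom)
  have mem: "lam (ob (Hom B a b)) (Comp B a b c f) \<in> ob (vhom (Hom B a b) (Hom B a c))"
    if "f \<in> ob (Hom B b c)" for f
    using B a b c that by (intro vhom_lam vfunctorI is_vccat_comp is_vccat_whisker_left)
  show "vfunctor (Hom B b c) (Hom VCat (FObj (hom_from B a) b) (FObj (hom_from B a) c))
     (FMap (hom_from B a) b c)"
    unfolding VCat_simps hom_from_simps(1)
  proof (rule vfunctorI)
    fix f' f assume f: "f' \<in> ob (Hom B b c)" "f \<in> ob (Hom B b c)"
    show "dist (Hom B b c) f' f
        \<le> dist (vhom (Hom B a b) (Hom B a c)) (FMap (hom_from B a) b c f') (FMap (hom_from B a) b c f)"
      using B a b c f
      by (auto simp: dist_vhom mem small intro!: INF_greatest is_vccat_whisker_right)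
  qed (simp add: mem)
  show "FMap (hom_from B a) b d (Comp B b c d g f) =
      Comp VCat (FObj (hom_from B a) b) (FObj (hom_from B a) c) (FObj (hom_from B a) d)
        (FMap (hom_from B a) c d g) (FMap (hom_from B a) b c f)"
    if "f \<in> ob (Hom B b c)" "g \<in> ob (Hom B c d)" for f g
    using B a b c d that
    by (auto simp: lam_eq_iff small is_vccat_assoc is_vccat_hom is_vccat_comp)
qed (use B a in \<open>auto simp: is_vccat_hom is_vccat_id_left lam_eq_iff\<close>)

lemma is_vcfun_hom_to:
  assumes B: "is_vccat B" and c: "c \<in> Obj B"
  shows "is_vcfun (vc_op B) VCat (hom_to B c)"
proof -
  have "hom_to B c = hom_from (vc_op B) c"
    by (simp add: hom_to_def hom_from_def)
  then show ?thesis
    using is_vcfun_hom_from[of "vc_op B" c] B c by simp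
qed

lemma is_vcfun_hom_along:
  assumes P: "is_vcfun K B P" and c: "c \<in> Obj B"
  shows "is_vcfun (vc_op K) VCat (hom_along B P c)"
  unfolding hom_along_def
  using is_vcfun_comp[OF is_vcfun_op[OF P] is_vcfun_hom_to[OF is_vcfun_cod[OF P] c]] .


section \<open>Weighted colimits\<close>

text \<open>Arrows of \<open>VCat\<close> are graphs and are equal when they agree pointwise, so
  naturality becomes an equation between elements. The weight is contravariant: an arrow
  \<open>f\<close> from \<open>j\<close> to \<open>k\<close> acts from \<open>FObj W k\<close> to
  \<open>FObj W j\<close>.\<close>

lemma nat_trans_hom_along_iff:
  assumes W: "is_vcfun (vc_op K) VCat W" and P: "is_vcfun K B P" and c: "c \<in> Obj B"
  shows "\<alpha> \<in> nat_trans (vc_op K) VCat W (hom_along B P c) \<longleftrightarrow>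
    \<alpha> \<in> extensional (Obj K) \<and>
    (\<forall>k\<in>Obj K. \<alpha> k \<in> ob (vhom (FObj W k) (Hom B (FObj P k) c))) \<and>
    (\<forall>j\<in>Obj K. \<forall>k\<in>Obj K. \<forall>f\<in>ob (Hom K j k). \<forall>w\<in>ob (FObj W k).
      app (\<alpha> j) (app (FMap W k j f) w) =
      Comp B (FObj P j) (FObj P k) c (app (\<alpha> k) w) (FMap P j k f))"
    (is "_ \<longleftrightarrow> ?E \<and> ?C \<and> ?N")
proof -
  have "\<alpha> \<in> nat_trans (vc_op K) VCat W (hom_along B P c) \<longleftrightarrow> ?E \<and> ?C \<and>
    (\<forall>k\<in>Obj K. \<forall>j\<in>Obj K. \<forall>f\<in>ob (Hom K j k).
      Comp VCat (FObj W k) (Hom B (FObj P k) c) (Hom B (FObj P j) c)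
        (FMap (hom_along B P c) k j f) (\<alpha> k) =
      Comp VCat (FObj W k) (FObj W j) (Hom B (FObj P j) c) (\<alpha> j) (FMap W k j f))"
    (is "_ \<longleftrightarrow> ?E \<and> ?C \<and> ?N'")
    unfolding nat_trans_def PiE_iff by auto
  also have "?E \<and> ?C \<and> ?N' \<longleftrightarrow> ?E \<and> ?C \<and> ?N"
  proof -
    \<comment> \<open>Under \<open>?C\<close> the value \<open>app (\<alpha> k) w\<close> lies in
      the domain of the graph \<open>FMap (hom_along B P c) k j f\<close>, so that the left
      composite can be evaluated.\<close>
    have "?N' \<longleftrightarrow> ?N" if C: ?C
    proof -
      have "Comp VCat (FObj W k) (Hom B (FObj P k) c) (Hom B (FObj P j) c)
          (FMap (hom_along B P c) k j f) (\<alpha> k) =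
        Comp VCat (FObj W k) (FObj W j) (Hom B (FObj P j) c) (\<alpha> j) (FMap W k j f) \<longleftrightarrow>
        (\<forall>w\<in>ob (FObj W k). app (\<alpha> j) (app (FMap W k j f) w) =
          Comp B (FObj P j) (FObj P k) c (app (\<alpha> k) w) (FMap P j k f))"
        if jk: "j \<in> Obj K" "k \<in> Obj K" for j k f
      proof -
        have Wk: "small (ob (FObj W k))"
          using is_vcfun_FObj[OF W, of k] jk by simp
        have Bk: "small (ob (Hom B (FObj P k) c))"
          using is_vccat_hom[OF is_vcfun_cod[OF P] is_vcfun_FObj[OF P jk(2)] c] by simp
        have "app (\<alpha> k) w \<in> ob (Hom B (FObj P k) c)" if "w \<in> ob (FObj W k)" for w
          using vhom_app[OF Wk _ that] C jk by blast
        then show ?thesis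
          using Wk Bk by (auto simp: lam_eq_iff)
      qed
      then show ?thesis
        by (simp del: VCat_simps hom_along_simps) blast
    qed
    then show ?thesis
      by blast
  qed
  finally show ?thesis .
qed

text \<open>Functoriality of \<open>F\<close> carries the naturality equation of
  \<open>\<mu>\<close> over. This is the cocone which \<open>preserves_colimit\<close> requires to
  be colimiting.\<close>

lemma nat_trans_preserved:
  assumes W: "is_vcfun (vc_op K) VCat W" and P: "is_vcfun K B P" and c: "c \<in> Obj B"
    and F: "is_vcfun B B' F"
    and \<mu>: "\<mu> \<in> nat_trans (vc_op K) VCat W (hom_along B P c)"
  shows "(\<lambda>k\<in>Obj K. lam (ob (FObj W k)) (\<lambda>w. FMap F (FObj P k) c (app (\<mu> k) w)))
    \<in> nat_trans (vc_op K) VCat W (hom_along B' (vcfun_comp F P) (FObj F c))"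
proof -
  note PO = is_vcfun_FObj[OF P]
  have mu: "\<mu> k \<in> ob (vhom (FObj W k) (Hom B (FObj P k) c))" if "k \<in> Obj K" for k
    using \<mu> that by (simp add: nat_trans_hom_along_iff[OF W P c])
  have nat: "app (\<mu> j) (app (FMap W k j f) w) =
      Comp B (FObj P j) (FObj P k) c (app (\<mu> k) w) (FMap P j k f)"
    if "j \<in> Obj K" "k \<in> Obj K" "f \<in> ob (Hom K j k)" "w \<in> ob (FObj W k)" for j k f w
    using \<mu> that by (simp add: nat_trans_hom_along_iff[OF W P c])
  have small: "small (ob (FObj W k))" if "k \<in> Obj K" for k
    using is_vcfun_FObj[OF W, of k] that by simp
  have FW: "app (FMap W k j f) w \<in> ob (FObj W j)"
    if "j \<in> Obj K" "k \<in> Obj K" "f \<in> ob (Hom K j k)" "w \<in> ob (FObj W k)" for j k f w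
    using is_vcfun_FMap[OF W, of k j f] that small by (auto intro: vhom_app)
  have comp: "lam (ob (FObj W k)) (\<lambda>w. FMap F (FObj P k) c (app (\<mu> k) w))
      \<in> ob (vhom (FObj W k) (Hom B' (FObj F (FObj P k)) (FObj F c)))" if "k \<in> Obj K" for k
    using that c
    by (intro vhom_lam vfunctor_comp[OF vhom_vfunctor[OF small mu] is_vcfun_vfunctor[OF F]] PO)
  show ?thesis
    unfolding nat_trans_hom_along_iff[OF W is_vcfun_comp[OF P F] is_vcfun_FObj[OF F c]]
    using comp
    by (auto simp: small FW nat is_vcfun_Comp[OF F PO PO c is_vcfun_FMap[OF P] vhom_app[OF small mu]])
qed

text \<open>For a cocone \<open>\<mu>\<close> this is the composite
  \<open>B(P-,f) \<circ> \<mu>\<close> of the Yoneda comparison in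
  \<open>is_weighted_colimit\<close>, with the inner graph already evaluated.\<close>

definition cocone_comp ::
  "('k, 'u::set_universe, 'v::comm_quantale) vccat \<Rightarrow> ('p, 'u, 'v) vccat
     \<Rightarrow> ('k, ('u, 'v) vcat, 'u) vcfun \<Rightarrow> ('k, 'p, 'u) vcfun \<Rightarrow> 'p \<Rightarrow> 'p
     \<Rightarrow> 'u \<Rightarrow> ('k \<Rightarrow> 'u) \<Rightarrow> ('k \<Rightarrow> 'u)" where
  "cocone_comp K B W P C b f \<mu> =
    (\<lambda>k\<in>Obj K. lam (ob (FObj W k)) (\<lambda>w. Comp B (FObj P k) C b f (app (\<mu> k) w)))"

lemma cocone_app:
  assumes W: "is_vcfun (vc_op K) VCat W" and P: "is_vcfun K B P" and C: "C \<in> Obj B"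
    and \<mu>: "\<mu> \<in> nat_trans (vc_op K) VCat W (hom_along B P C)"
    and k: "k \<in> Obj K" and w: "w \<in> ob (FObj W k)"
  shows "app (\<mu> k) w \<in> ob (Hom B (FObj P k) C)"
proof (rule vhom_app)
  show "\<mu> k \<in> ob (vhom (FObj W k) (Hom B (FObj P k) C))"
    using \<mu> k by (simp add: nat_trans_hom_along_iff[OF W P C])
  show "small (ob (FObj W k))"
    using is_vcfun_FObj[OF W, of k] k by simp
qed (fact w)

lemma is_weighted_colimit_iff:
  "is_weighted_colimit K B W P C \<mu> \<longleftrightarrow>
     is_vcfun (vc_op K) VCat W \<and> is_vcfun K B P \<and> C \<in> Obj B \<and>
     \<mu> \<in> nat_trans (vc_op K) VCat W (hom_along B P C) \<and>
     (\<forall>b\<in>Obj B.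
        vcat_iso (Hom B C b) (nat_vcat (vc_op K) VCat W (hom_along B P b))
          (\<lambda>f. cocone_comp K B W P C b f \<mu>))"
proof -
  have "(\<lambda>k\<in>Obj K.
             Comp VCat (FObj W k) (Hom B (FObj P k) C) (Hom B (FObj P k) b)
               (FMap (hom_from B (FObj P k)) C b f) (\<mu> k)) = cocone_comp K B W P C b f \<mu>"
    if W: "is_vcfun (vc_op K) VCat W" and P: "is_vcfun K B P" and C: "C \<in> Obj B"
      and \<mu>: "\<mu> \<in> nat_trans (vc_op K) VCat W (hom_along B P C)" for b f
  proof -
    have Wk: "small (ob (FObj W k))" if "k \<in> Obj K" for k
      using is_vcfun_FObj[OF W, of k] that by simp
    have Bk: "small (ob (Hom B (FObj P k) C))" if "k \<in> Obj K" for k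
      using is_vccat_hom[OF is_vcfun_cod[OF P] is_vcfun_FObj[OF P that] C] by simp
    show ?thesis
      by (rule ext) (simp add: cocone_comp_def lam_eq_iff Wk Bk cocone_app[OF W P C \<mu>])
  qed
  then show ?thesis
    unfolding is_weighted_colimit_def by (simp cong: conj_cong)
qed

lemma ob_nat_vcat [simp]: "ob (nat_vcat A B F G) = nat_trans A B F G"
  by (simp add: nat_vcat_def)

lemma dist_nat_vcat:
  "\<alpha> \<in> nat_trans A B F G \<Longrightarrow> \<beta> \<in> nat_trans A B F G \<Longrightarrow> dist (nat_vcat A B F G) \<alpha> \<beta> =
    (INF a\<in>Obj A. dist (Hom B (FObj F a) (FObj G a)) (\<alpha> a) (\<beta> a))"
  by (simp add: nat_vcat_def)

lemma cocone_comp_Id: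
  assumes W: "is_vcfun (vc_op K) VCat W" and P: "is_vcfun K B P" and C: "C \<in> Obj B"
    and \<mu>: "\<mu> \<in> nat_trans (vc_op K) VCat W (hom_along B P C)"
  shows "cocone_comp K B W P C C (Id B C) \<mu> = \<mu>"
proof (rule extensionalityI)
  show "cocone_comp K B W P C C (Id B C) \<mu> \<in> extensional (Obj K)"
    by (simp add: cocone_comp_def)
  show "\<mu> \<in> extensional (Obj K)"
    using \<mu> by (simp add: nat_trans_hom_along_iff[OF W P C])
  fix k assume k: "k \<in> Obj K"
  have "cocone_comp K B W P C C (Id B C) \<mu> k = lam (ob (FObj W k)) (app (\<mu> k))"
    using k is_vccat_id_left[OF is_vcfun_cod[OF P] is_vcfun_FObj[OF P k] C]
      cocone_app[OF W P C \<mu> k]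
    by (auto simp: cocone_comp_def intro!: lam_cong)
  also have "\<dots> = \<mu> k"
    using \<mu> k is_vcfun_FObj[OF W, of k]
    by (auto simp: nat_trans_hom_along_iff[OF W P C] intro!: vhom_eta)
  finally show "cocone_comp K B W P C C (Id B C) \<mu> k = \<mu> k" .
qed

lemma cocone_comp_Comp:
  assumes W: "is_vcfun (vc_op K) VCat W" and P: "is_vcfun K B P"
    and C: "C \<in> Obj B" "C' \<in> Obj B" "C'' \<in> Obj B"
    and \<mu>: "\<mu> \<in> nat_trans (vc_op K) VCat W (hom_along B P C)"
    and f: "f \<in> ob (Hom B C C')" and g: "g \<in> ob (Hom B C' C'')"
  shows "cocone_comp K B W P C C'' (Comp B C C' C'' g f) \<mu> =
    cocone_comp K B W P C' C'' g (cocone_comp K B W P C C' f \<mu>)"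
proof (rule ext)
  fix k
  have "small (ob (FObj W k))" if "k \<in> Obj K"
    using is_vcfun_FObj[OF W, of k] that by simp
  then show "cocone_comp K B W P C C'' (Comp B C C' C'' g f) \<mu> k =
    cocone_comp K B W P C' C'' g (cocone_comp K B W P C C' f \<mu>) k"
    using is_vccat_assoc[OF is_vcfun_cod[OF P] is_vcfun_FObj[OF P] C _ f g]
      cocone_app[OF W P C(1) \<mu>]
    by (auto simp: cocone_comp_def lam_eq_iff)
qed

lemma cocone_comp_nat_trans:
  assumes W: "is_vcfun (vc_op K) VCat W" and P: "is_vcfun K B P"
    and C: "C \<in> Obj B" and b: "b \<in> Obj B"
    and \<mu>: "\<mu> \<in> nat_trans (vc_op K) VCat W (hom_along B P C)"
    and f: "f \<in> ob (Hom B C b)"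
  shows "cocone_comp K B W P C b f \<mu> \<in> nat_trans (vc_op K) VCat W (hom_along B P b)"
proof -
  note B = is_vcfun_cod[OF P] and PO = is_vcfun_FObj[OF P]
  have mu: "\<mu> k \<in> ob (vhom (FObj W k) (Hom B (FObj P k) C))" if "k \<in> Obj K" for k
    using \<mu> that by (simp add: nat_trans_hom_along_iff[OF W P C])
  have nat: "app (\<mu> j) (app (FMap W k j m) w) =
      Comp B (FObj P j) (FObj P k) C (app (\<mu> k) w) (FMap P j k m)"
    if "j \<in> Obj K" "k \<in> Obj K" "m \<in> ob (Hom K j k)" "w \<in> ob (FObj W k)" for j k m w
    using \<mu> that by (simp add: nat_trans_hom_along_iff[OF W P C])
  have small: "small (ob (FObj W k))" if "k \<in> Obj K" for k
    using is_vcfun_FObj[OF W, of k] that by simp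
  have FW: "app (FMap W k j m) w \<in> ob (FObj W j)"
    if "j \<in> Obj K" "k \<in> Obj K" "m \<in> ob (Hom K j k)" "w \<in> ob (FObj W k)" for j k m w
    using is_vcfun_FMap[OF W, of k j m] that small by (auto intro: vhom_app)
  have comp: "lam (ob (FObj W k)) (\<lambda>w. Comp B (FObj P k) C b f (app (\<mu> k) w))
      \<in> ob (vhom (FObj W k) (Hom B (FObj P k) b))" if k: "k \<in> Obj K" for k
    using is_vccat_comp[OF B PO[OF k] C b _ f] is_vccat_whisker_left[OF B PO[OF k] C b _ _ f]
    by (intro vhom_lam vfunctor_comp[OF vhom_vfunctor[OF small[OF k] mu[OF k]]] vfunctorI) auto
  show ?thesis
    unfolding nat_trans_hom_along_iff[OF W P b]
    using comp
    by (auto simp: cocone_comp_def small FW nat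
        is_vccat_assoc[OF B PO PO C b is_vcfun_FMap[OF P] vhom_app[OF small mu] f])
qed

text \<open>Each cocone is the image of an arrow under the comparison bijection of the other; a
  composite of these arrows and the identity have the same image, so injectivity identifies them.
  The last conclusion is kept because it allows an arbitrary cocone to be computed from the
  canonical one.\<close>

lemma weighted_colimit_unique:
  assumes "is_weighted_colimit K B W P C \<mu>" "is_weighted_colimit K B W P C' \<mu>'"
  obtains h g where "h \<in> ob (Hom B C C')" "g \<in> ob (Hom B C' C)"
    "Comp B C C' C g h = Id B C" "Comp B C' C C' h g = Id B C'"
    "cocone_comp K B W P C C' h \<mu> = \<mu>'"
proof -
  have W: "is_vcfun (vc_op K) VCat W" and P: "is_vcfun K B P"
    and C: "C \<in> Obj B" "C' \<in> Obj B"
    and \<mu>: "\<mu> \<in> nat_trans (vc_op K) VCat W (hom_along B P C)"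
      "\<mu>' \<in> nat_trans (vc_op K) VCat W (hom_along B P C')"
    using assms by (auto simp: is_weighted_colimit_iff)
  note B = is_vcfun_cod[OF P]
  have bij: "bij_betw (\<lambda>f. cocone_comp K B W P C b f \<mu>) (ob (Hom B C b))
      (nat_trans (vc_op K) VCat W (hom_along B P b))"
    "bij_betw (\<lambda>f. cocone_comp K B W P C' b f \<mu>') (ob (Hom B C' b))
      (nat_trans (vc_op K) VCat W (hom_along B P b))" if "b \<in> Obj B" for b
    using assms that by (auto simp: is_weighted_colimit_iff vcat_iso_iff)
  obtain h where h: "h \<in> ob (Hom B C C')" "cocone_comp K B W P C C' h \<mu> = \<mu>'"
    using \<mu>(2) unfolding bij_betw_imp_surj_on[OF bij(1)[OF C(2)], symmetric] by (metis imageE)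
  obtain g where g: "g \<in> ob (Hom B C' C)" "cocone_comp K B W P C' C g \<mu>' = \<mu>"
    using \<mu>(1) unfolding bij_betw_imp_surj_on[OF bij(2)[OF C(1)], symmetric] by (metis imageE)
  have "Comp B C C' C g h = Id B C"
  proof (rule inj_onD[OF bij_betw_imp_inj_on[OF bij(1)[OF C(1)]]])
    show "cocone_comp K B W P C C (Comp B C C' C g h) \<mu> = cocone_comp K B W P C C (Id B C) \<mu>"
      by (simp add: cocone_comp_Comp[OF W P C C(1) \<mu>(1) h(1) g(1)] h g
          cocone_comp_Id[OF W P C(1) \<mu>(1)])
  qed (rule is_vccat_comp[OF B C(1,2,1) h(1) g(1)] is_vccat_id[OF B C(1)])+
  moreover have "Comp B C' C C' h g = Id B C'"
  proof (rule inj_onD[OF bij_betw_imp_inj_on[OF bij(2)[OF C(2)]]])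
    show "cocone_comp K B W P C' C' (Comp B C' C C' h g) \<mu>' =
        cocone_comp K B W P C' C' (Id B C') \<mu>'"
      by (simp add: cocone_comp_Comp[OF W P C(2,1,2) \<mu>(2) g(1) h(1)] h g
          cocone_comp_Id[OF W P C(2) \<mu>(2)])
  qed (rule is_vccat_comp[OF B C(2,1,2) g(1) h(1)] is_vccat_id[OF B C(2)])+
  ultimately show thesis
    using that h g by blast
qed

lemma VCat_iso_bij_isometry:
  assumes X: "small_vcat X" and Y: "small_vcat Y"
    and h: "h \<in> ob (vhom X Y)" and g: "g \<in> ob (vhom Y X)"
    and gh: "Comp VCat X Y X g h = Id VCat X" and hg: "Comp VCat Y X Y h g = Id VCat Y"
  shows "bij_betw (app h) (ob X) (ob Y)"
    and "x' \<in> ob X \<Longrightarrow> x \<in> ob X \<Longrightarrow> dist Y (app h x') (app h x) = dist X x' x"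
proof -
  have "vcat_iso X Y (app h)"
    unfolding vcat_iso_def
    using vhom_vfunctor[OF _ h] vhom_vfunctor[OF _ g] gh hg X Y
    by (intro conjI exI[of _ "app g"]) (auto simp: lam_eq_iff)
  then show "bij_betw (app h) (ob X) (ob Y)"
    "x' \<in> ob X \<Longrightarrow> x \<in> ob X \<Longrightarrow> dist Y (app h x') (app h x) = dist X x' x"
    by (auto simp: vcat_iso_iff)
qed


section \<open>Discrete V-cat-categories\<close>

lemma free_vccat_simps [simp]:
  "Obj (free_vccat C) = OObj C"
  "Hom (free_vccat C) a b = vdiscrete (OHom C a b)"
  "Id (free_vccat C) = OId C"
  "Comp (free_vccat C) = OComp C"
  by (simp_all add: free_vccat_def)

text \<open>As \<open>1 * 1 = 1\<close> and \<open>bot\<close> absorbs, composition of discrete homs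
  is automatically a V-functor; the axioms of an ordinary category remain.\<close>

lemma is_vccat_free_vccat:
  assumes "\<And>a b. a \<in> OObj C \<Longrightarrow> b \<in> OObj C \<Longrightarrow> small (OHom C a b)"
    and "\<And>a. a \<in> OObj C \<Longrightarrow> OId C a \<in> OHom C a a"
    and comp: "\<And>a b c f g. a \<in> OObj C \<Longrightarrow> b \<in> OObj C \<Longrightarrow> c \<in> OObj C \<Longrightarrow>
      f \<in> OHom C a b \<Longrightarrow> g \<in> OHom C b c \<Longrightarrow> OComp C a b c g f \<in> OHom C a c"
    and "\<And>a b f. a \<in> OObj C \<Longrightarrow> b \<in> OObj C \<Longrightarrow> f \<in> OHom C a b \<Longrightarrow>
      OComp C a b b (OId C b) f = f \<and> OComp C a a b f (OId C a) = f"
    and "\<And>a b c d f g h. a \<in> OObj C \<Longrightarrow> b \<in> OObj C \<Longrightarrow> c \<in> OObj C \<Longrightarrow> d \<in> OObj C \<Longrightarrow>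
      f \<in> OHom C a b \<Longrightarrow> g \<in> OHom C b c \<Longrightarrow> h \<in> OHom C c d \<Longrightarrow>
      OComp C a b d (OComp C b c d h g) f = OComp C a c d h (OComp C a b c g f)"
  shows "is_vccat (free_vccat C :: ('o, 'u::set_universe, 'v::comm_quantale) vccat)"
proof -
  have "vfunctor (vtensor (vdiscrete (OHom C b c)) (vdiscrete (OHom C a b)))
      (vdiscrete (OHom C a c) :: ('u, 'v) vcat) (\<lambda>(g, f). OComp C a b c g f)"
    if "a \<in> OObj C" "b \<in> OObj C" "c \<in> OObj C" for a b c
    using comp[OF that] by (auto intro!: vfunctorI simp: dist_vdiscrete)
  then show ?thesis
    using assms by (simp add: is_vccat_def)
qed

lemma is_vcfun_discreteI:
  assumes A: "is_vccat A" and B: "is_vccat B"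
    and H: "\<And>a b. a \<in> Obj A \<Longrightarrow> b \<in> Obj A \<Longrightarrow> Hom A a b = vdiscrete (H a b)"
    and F: "\<And>a. a \<in> Obj A \<Longrightarrow> FObj F a \<in> Obj B"
    and "\<And>a b f. a \<in> Obj A \<Longrightarrow> b \<in> Obj A \<Longrightarrow> f \<in> H a b \<Longrightarrow>
      FMap F a b f \<in> ob (Hom B (FObj F a) (FObj F b))"
    and "\<And>a. a \<in> Obj A \<Longrightarrow> FMap F a a (Id A a) = Id B (FObj F a)"
    and "\<And>a b c f g. a \<in> Obj A \<Longrightarrow> b \<in> Obj A \<Longrightarrow> c \<in> Obj A \<Longrightarrow> f \<in> H a b \<Longrightarrow> g \<in> H b c \<Longrightarrow>
      FMap F a c (Comp A a b c g f) =
      Comp B (FObj F a) (FObj F b) (FObj F c) (FMap F b c g) (FMap F a b f)"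
  shows "is_vcfun A B F"
  unfolding is_vcfun_def
  using assms
  by (auto intro!: vfunctor_vdiscrete small_vcat_is_vcat[OF is_vccat_hom[OF B]])

section \<open>Sets and the functor \<open>D\<close>\<close>

lemma SetV_simps [simp]:
  "Obj SetV = UNIV"
  "Hom SetV S T = vdiscrete {lam (elts S) f | f. f ` elts S \<subseteq> elts T}"
  "Id SetV S = lam (elts S) (\<lambda>x. x)"
  "Comp SetV S T U g f = lam (elts S) (\<lambda>x. app g (app f x))"
  by (simp_all add: SetV_def set_ocat_def)

lemma is_vccat_SetV [simp]: "is_vccat SetV"
  unfolding SetV_def
proof (rule is_vccat_free_vccat)
  show "OComp set_ocat S T U g f \<in> OHom set_ocat S U"
    if "f \<in> OHom set_ocat S T" "g \<in> OHom set_ocat T U" for S T U f g :: 'a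
    using that by (fastforce simp: set_ocat_def)
  show "small (OHom set_ocat S T)" for S T :: 'a
    by (simp add: set_ocat_def small_maps)
qed (auto simp: set_ocat_def lam_eq_iff image_subset_iff)

lemma D_fun_simps [simp]: "FObj D_fun S = vdiscrete (elts S)" "FMap D_fun S T f = f"
  by (simp_all add: D_fun_def)

lemma ob_vhom_vdiscrete:
  "is_vcat Y \<Longrightarrow> ob (vhom (vdiscrete A) Y) = {lam A f | f. f ` A \<subseteq> ob Y}"
  unfolding set_eq_iff in_ob_vhom mem_Collect_eq image_subset_iff
  by (metis ob_vdiscrete vfunctor_ob vfunctor_vdiscrete)

lemma is_vcfun_D_fun [simp]: "is_vcfun SetV VCat D_fun"
  by (rule is_vcfun_discreteI[OF is_vccat_SetV is_vccat_VCat])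
    (auto simp: ob_vhom_vdiscrete small_vcat_is_vcat)

text \<open>Integrality is needed for the case of empty \<open>A\<close>, where the only map has self-distance \<open>top\<close>.\<close>

lemma vhom_vdiscrete:
  assumes integral: "(1 :: 'v::comm_quantale) = top"
    and A: "small A" and B: "small B"
  shows "vhom (vdiscrete A) (vdiscrete B :: ('u::set_universe, 'v) vcat) =
    vdiscrete {lam A f | f. f ` A \<subseteq> B}" (is "?L = vdiscrete ?H")
proof (rule vcat.equality)
  have ob: "ob ?L = ?H"
    using B by (simp add: ob_vhom_vdiscrete small_vcat_is_vcat)
  then show "ob ?L = ob (vdiscrete ?H)"
    by simp
  show "dist ?L = dist (vdiscrete ?H)"
  proof (intro ext)
    fix f g
    show "dist ?L f g = dist (vdiscrete ?H) f g"
    proof (cases "f \<in> ?H \<and> g \<in> ?H")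
      case True
      then have fg: "f \<in> ob ?L" "g \<in> ob ?L"
        using ob by auto
      have app: "app f a \<in> B" if "a \<in> A" for a
        using vhom_app[OF _ fg(1)] A that by simp
      have "(INF a\<in>A. dist (vdiscrete B :: ('u, 'v) vcat) (app f a) (app g a)) =
          (if f = g then 1 else bot)"
      proof (cases "f = g")
        case True
        then show ?thesis
          using app by (simp add: dist_vdiscrete integral cong: INF_cong_simp)
      next
        case False
        then obtain a where a: "a \<in> A" "app f a \<noteq> app g a"
          using vhom_ext[OF _ fg] A by auto
        then have "(INF a\<in>A. dist (vdiscrete B :: ('u, 'v) vcat) (app f a) (app g a)) \<le> bot"
          by (intro INF_lower2[of a]) (simp_all add: dist_vdiscrete)
        then show ?thesis
          using False by (simp add: bot_unique)
      qed
      then show ?thesis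
        using True by (simp add: dist_vhom[OF fg] dist_vdiscrete)
    next
      case False
      then have "dist ?L f g = bot"
        using ob by (auto simp: vhom_def Let_def)
      then show ?thesis
        using False by (auto simp: dist_vdiscrete)
    qed
  qed
qed simp

text \<open>By \<open>vhom_vdiscrete\<close> both homs are the same V-category, and
  \<open>D_fun\<close> acts on it as the identity because the codes of the arrows coincide.\<close>

lemma fully_faithful_D_fun:
  assumes "(1 :: 'v::comm_quantale) = top"
  shows "fully_faithful SetV VCat (D_fun :: ('u::set_universe, ('u, 'v) vcat, 'u) vcfun)"
  unfolding fully_faithful_def by (simp add: vcat_iso_iff vhom_vdiscrete[OF assms] bij_betw_def inj_on_def)


section \<open>Density\<close>

text \<open>The colimit cocone has the identity of \<open>[DS,X]\<close> as its component at
  \<open>S\<close>, and the comparison \<open>?\<Phi>\<close> sends \<open>f\<close> to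
  postcomposition with \<open>f\<close>. Injectivity, surjectivity and the comparison of distances
  all come down to the component at the one-element set.\<close>

lemma is_dense_D_fun:
  "is_dense SetV VCat (D_fun :: ('u::set_universe, ('u, 'v::comm_quantale) vcat, 'u) vcfun)"
proof -
  let ?D = "D_fun :: ('u, ('u, 'v) vcat, 'u) vcfun"
  have nat: "(\<lambda>a\<in>Obj SetV. Id VCat (FObj ?D a)) \<in> nat_trans SetV VCat ?D (vcfun_comp vcfun_id ?D)"
    using vhom_id[of "vdiscrete (elts _)"] by (auto simp: nat_trans_def lam_eq_iff)
  have colim: "is_weighted_colimit SetV VCat (hom_along VCat ?D X) ?D X
      (\<lambda>S\<in>UNIV. lam (ob (vhom (vdiscrete (elts S)) X)) (\<lambda>g. g))" (is "is_weighted_colimit _ _ ?W _ _ ?\<mu>")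
    if X: "small_vcat X" for X
  proof -
    have W: "is_vcfun (vc_op SetV) VCat (hom_along VCat ?D Y)" if "small_vcat Y" for Y
      using that by (simp add: is_vcfun_hom_along)
    note iff = nat_trans_hom_along_iff[OF W[OF X] is_vcfun_D_fun]
    have small_hom: "small (ob (vhom (vdiscrete (elts S)) Y))" if "small_vcat Y" for S :: 'u and Y :: "('u, 'v) vcat"
      using that by simp
    have \<mu>: "?\<mu> \<in> nat_trans (vc_op SetV) VCat ?W (hom_along VCat ?D X)"
    proof -
      have "app (lam (ob (vhom (vdiscrete (elts S)) X)) (\<lambda>g. g))
            (lam (elts S) (\<lambda>x. app g (app (lam (elts S) m) x))) =
          lam (elts S) (\<lambda>x. app g (app (lam (elts S) m) x))"
        if "g \<in> ob (vhom (vdiscrete (elts T)) X)" "m ` elts S \<subseteq> elts T" for S T g m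
      proof -
        have "app g (m x) \<in> ob X" if "x \<in> elts S" for x
          using vhom_app[of "vdiscrete (elts T)" g X "m x"] \<open>g \<in> _\<close> \<open>_ \<subseteq> elts T\<close> that by auto
        then have "lam (elts S) (\<lambda>x. app g (app (lam (elts S) m) x)) \<in> ob (vhom (vdiscrete (elts S)) X)"
          using X by (auto simp: ob_vhom_vdiscrete small_vcat_is_vcat lam_eq_iff
              intro!: exI[of _ "\<lambda>x. app g (m x)"])
        then show ?thesis
          using X by (simp add: small_hom)
      qed
      then show ?thesis
        using X by (auto simp: iff vhom_id small_hom)
    qed
    let ?one = "mk {u0} :: 'u"
    \<comment> \<open>One graph in two roles: a V-functor from the discrete category on
      \<open>?one\<close> picking an object, and a map from \<open>?one\<close> to a set picking an
      element.\<close>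
    let ?const = "\<lambda>x. lam {u0} (\<lambda>_. x) :: 'u"
    have "vcat_iso (vhom X Y) (nat_vcat (vc_op SetV) VCat ?W (hom_along VCat ?D Y))
        (\<lambda>f. cocone_comp SetV VCat ?W ?D X Y f ?\<mu>)" (is "vcat_iso _ ?N ?\<Phi>")
      if Y: "small_vcat Y" for Y
      unfolding vcat_iso_iff
    proof (intro conjI ballI)
      note iffY = nat_trans_hom_along_iff[OF W[OF X] is_vcfun_D_fun, of Y]
      have \<Phi>_app: "app (?\<Phi> f S) g = lam (elts S) (\<lambda>s. app f (app g s))"
        if "g \<in> ob (vhom (vdiscrete (elts S)) X)" for f g S
        using that by (simp add: cocone_comp_def small_hom[OF X])
      have \<Phi>_nat: "?\<Phi> f \<in> nat_trans (vc_op SetV) VCat ?W (hom_along VCat ?D Y)"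
        if "f \<in> ob (vhom X Y)" for f
        using X Y that by (intro cocone_comp_nat_trans W \<mu>) auto
      have const: "?const x \<in> ob (vhom (vdiscrete (elts ?one)) X)" if "x \<in> ob X" for x
        using that X by (auto simp: ob_vhom_vdiscrete small_vcat_is_vcat)
      have \<Phi>_const: "app (app (?\<Phi> f ?one) (?const x)) u0 = app f x" if "x \<in> ob X" for f x
        using \<Phi>_app[OF const[OF that]] by simp
      have "\<exists>f\<in>ob (vhom X Y). ?\<Phi> f = \<alpha>"
        if \<alpha>: "\<alpha> \<in> nat_trans (vc_op SetV) VCat ?W (hom_along VCat ?D Y)" for \<alpha>
      proof -
        have \<alpha>_hom: "\<alpha> S \<in> ob (vhom (vhom (vdiscrete (elts S)) X) (vhom (vdiscrete (elts S)) Y))" for S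
          using \<alpha> Y by (simp add: iffY)
        have nat: "app (\<alpha> S) (app (FMap ?W T S m) g) =
            Comp VCat (FObj ?D S) (FObj ?D T) Y (app (\<alpha> T) g) (FMap ?D S T m)"
          if "m \<in> ob (Hom (SetV :: ('u, 'u, 'v) vccat) S T)" "g \<in> ob (FObj ?W T)" for S T m g
          using \<alpha> Y that by (simp add: iffY del: VCat_simps(4) hom_along_simps(2) SetV_simps(2))
        have \<alpha>_app: "app (\<alpha> S) g \<in> ob (vhom (vdiscrete (elts S)) Y)"
          if "g \<in> ob (vhom (vdiscrete (elts S)) X)" for S g
          using vhom_app[OF small_hom[OF X] \<alpha>_hom that] .
        define h where "h x = app (app (\<alpha> ?one) (?const x)) u0" for x
        have h: "vfunctor X Y h"
        proof (rule vfunctorI)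
          show "h x \<in> ob Y" if "x \<in> ob X" for x
            using vhom_app[OF _ \<alpha>_app[OF const[OF that]], of u0] by (simp add: h_def)
          fix x' x assume x: "x' \<in> ob X" "x \<in> ob X"
          \<comment> \<open>The infimum runs over a single point, so
            \<open>x \<mapsto> ?const x\<close> preserves distances exactly; V-functoriality of
            \<open>h\<close> then follows from that of \<open>\<alpha> ?one\<close>.\<close>
          have "dist X x' x = dist (vhom (vdiscrete (elts ?one)) X) (?const x') (?const x)"
            by (subst dist_vhom[OF const[OF x(1)] const[OF x(2)]]) simp
          also have "\<dots> \<le> dist (vhom (vdiscrete (elts ?one)) Y)
              (app (\<alpha> ?one) (?const x')) (app (\<alpha> ?one) (?const x))"
            by (intro vfunctor_dist[OF vhom_vfunctor[OF small_hom[OF X] \<alpha>_hom]] const x)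
          also have "\<dots> \<le> dist Y (h x') (h x)"
            unfolding h_def by (intro dist_vhom_le \<alpha>_app const x) simp
          finally show "dist X x' x \<le> dist Y (h x') (h x)" .
        qed
        then have f: "lam (ob X) h \<in> ob (vhom X Y)"
          by (rule vhom_lam)
        have "?\<Phi> (lam (ob X) h) S = \<alpha> S" for S
        proof (rule vhom_ext[OF small_hom[OF X] _ \<alpha>_hom])
          show "?\<Phi> (lam (ob X) h) S
              \<in> ob (vhom (vhom (vdiscrete (elts S)) X) (vhom (vdiscrete (elts S)) Y))"
            using \<Phi>_nat[OF f] Y by (simp add: iffY)
          fix g assume g: "g \<in> ob (vhom (vdiscrete (elts S)) X)"
          have gX: "app g s \<in> ob X" if "s \<in> elts S" for s
            using vhom_app[OF _ g] that by simp
          have "app (app (\<alpha> S) g) s = h (app g s)" if s: "s \<in> elts S" for s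
          proof -
            \<comment> \<open>Naturality along the point \<open>s\<close> of \<open>S\<close>
              reduces the value of \<open>\<alpha> S\<close> at \<open>s\<close> to the component at
              the one-element set, that is, to \<open>h\<close>.\<close>
            have "app (\<alpha> ?one) (app (FMap ?W S ?one (?const s)) g) =
              Comp VCat (FObj ?D ?one) (FObj ?D S) Y (app (\<alpha> S) g) (FMap ?D ?one S (?const s))"
            proof (rule nat)
              show "?const s \<in> ob (Hom (SetV :: ('u, 'u, 'v) vccat) ?one S)"
                using s by (auto intro!: exI[of _ "\<lambda>_. s"])
              show "g \<in> ob (FObj ?W S)"
                using g by simp
            qed
            moreover have "app (FMap ?W S ?one (?const s)) g = ?const (app g s)"
              using g by (simp add: small_hom[OF X] lam_eq_iff)
            ultimately show ?thesis
              by (simp add: h_def)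
          qed
          then have "lam (elts S) (\<lambda>s. h (app g s)) = lam (elts S) (app (app (\<alpha> S) g))"
            by (simp add: lam_eq_iff)
          also have "\<dots> = app (\<alpha> S) g"
            using vhom_eta[OF _ \<alpha>_app[OF g]] by simp
          finally show "app (?\<Phi> (lam (ob X) h) S) g = app (\<alpha> S) g"
            unfolding \<Phi>_app[OF g] using X gX by (simp cong: lam_cong)
        qed
        then show ?thesis
          using f by blast
      qed
      moreover have "inj_on ?\<Phi> (ob (vhom X Y))"
      proof (rule inj_onI)
        fix f f' assume f: "f \<in> ob (vhom X Y)" "f' \<in> ob (vhom X Y)" "?\<Phi> f = ?\<Phi> f'"
        show "f = f'"
          using \<Phi>_const[of _ f] \<Phi>_const[of _ f'] f X by (intro vhom_ext[OF _ f(1,2)]) auto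
      qed
      ultimately show "bij_betw ?\<Phi> (ob (vhom X Y)) (ob ?N)"
        using \<Phi>_nat unfolding bij_betw_def by (auto simp: image_iff)
      fix f f' assume f: "f \<in> ob (vhom X Y)" "f' \<in> ob (vhom X Y)"
      have \<Phi>_hom: "?\<Phi> f S \<in> ob (vhom (vhom (vdiscrete (elts S)) X) (vhom (vdiscrete (elts S)) Y))"
        if "f \<in> ob (vhom X Y)" for f S
        using \<Phi>_nat[OF that] Y by (simp add: iffY)
      have N: "dist ?N (?\<Phi> f) (?\<Phi> f') =
          (INF S. dist (vhom (vhom (vdiscrete (elts S)) X) (vhom (vdiscrete (elts S)) Y))
            (?\<Phi> f S) (?\<Phi> f' S))"
        using f by (simp add: dist_nat_vcat \<Phi>_nat)
      show "dist (vhom X Y) f f' = dist ?N (?\<Phi> f) (?\<Phi> f')"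
      proof (rule antisym)
        show "dist (vhom X Y) f f' \<le> dist ?N (?\<Phi> f) (?\<Phi> f')"
          unfolding N
        proof (rule INF_greatest)
          fix S :: 'u
          have "dist (vhom X Y) f f' \<le>
              dist (vhom (vdiscrete (elts S)) Y) (app (?\<Phi> f S) g) (app (?\<Phi> f' S) g)"
            if g: "g \<in> ob (vhom (vdiscrete (elts S)) X)" for g
            using is_vccat_whisker_right[OF is_vccat_VCat, of "vdiscrete (elts S)" X Y g f f']
              X Y f g by (simp add: \<Phi>_app[OF g])
          then show "dist (vhom X Y) f f' \<le>
              dist (vhom (vhom (vdiscrete (elts S)) X) (vhom (vdiscrete (elts S)) Y))
                (?\<Phi> f S) (?\<Phi> f' S)"
            unfolding dist_vhom[OF \<Phi>_hom[OF f(1)] \<Phi>_hom[OF f(2)]] by (rule INF_greatest)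
        qed
        \<comment> \<open>Dropping all sets but the one-element one and then evaluating at
          \<open>?const x\<close> leaves exactly the distance at \<open>x\<close>.\<close>
        show "dist ?N (?\<Phi> f) (?\<Phi> f') \<le> dist (vhom X Y) f f'"
          unfolding dist_vhom[OF f]
        proof (rule INF_greatest)
          fix x assume x: "x \<in> ob X"
          have \<Phi>_const_hom: "app (?\<Phi> f ?one) (?const x) \<in> ob (vhom (vdiscrete (elts ?one)) Y)"
            if "f \<in> ob (vhom X Y)" for f
            by (rule vhom_app[OF small_hom[OF X] \<Phi>_hom[OF that] const[OF x]])
          have "dist ?N (?\<Phi> f) (?\<Phi> f') \<le>
              dist (vhom (vhom (vdiscrete (elts ?one)) X) (vhom (vdiscrete (elts ?one)) Y))
                (?\<Phi> f ?one) (?\<Phi> f' ?one)"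
            unfolding N by (rule INF_lower) simp
          also have "\<dots> \<le> dist (vhom (vdiscrete (elts ?one)) Y)
              (app (?\<Phi> f ?one) (?const x)) (app (?\<Phi> f' ?one) (?const x))"
            using f by (intro dist_vhom_le \<Phi>_hom const x)
          also have "\<dots> \<le> dist Y (app (app (?\<Phi> f ?one) (?const x)) u0)
              (app (app (?\<Phi> f' ?one) (?const x)) u0)"
            using f by (intro dist_vhom_le \<Phi>_const_hom) auto
          also have "\<dots> = dist Y (app f x) (app f' x)"
            by (simp only: \<Phi>_const[OF x])
          finally show "dist ?N (?\<Phi> f) (?\<Phi> f') \<le> dist Y (app f x) (app f' x)" .
        qed
      qed
    qed
    then show ?thesis
      using X \<mu> W[OF X] by (simp add: is_weighted_colimit_iff)
  qed
  show ?thesis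
    unfolding is_dense_def is_pointwise_lan_def
  proof (intro conjI ballI)
    fix X :: "('u, 'v) vcat" assume "X \<in> Obj VCat"
    then have X: "small_vcat X"
      by simp
    \<comment> \<open>The unit in the definition of the Kan extension sends \<open>g\<close> to its
      composite with an identity, which is \<open>g\<close> again because \<open>g\<close> is a
      graph.\<close>
    have "(\<lambda>a\<in>Obj SetV. lam (ob (Hom VCat (FObj ?D a) X))
             (\<lambda>g. Comp VCat (FObj ?D a) (FObj vcfun_id (FObj ?D a)) (FObj vcfun_id X)
                    (FMap vcfun_id (FObj ?D a) X g) ((\<lambda>a\<in>Obj SetV. Id VCat (FObj ?D a)) a)))
      = (\<lambda>S\<in>UNIV. lam (ob (vhom (vdiscrete (elts S)) X)) (\<lambda>g. g))"
      by (auto intro!: ext lam_cong simp: vhom_eta[of "vdiscrete (elts _)", simplified] cong: lam_cong)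
    then show "is_weighted_colimit SetV VCat (hom_along VCat ?D X) ?D (FObj vcfun_id X)
      (\<lambda>a\<in>Obj SetV. lam (ob (Hom VCat (FObj ?D a) X))
             (\<lambda>g. Comp VCat (FObj ?D a) (FObj vcfun_id (FObj ?D a)) (FObj vcfun_id X)
                    (FMap vcfun_id (FObj ?D a) X g) ((\<lambda>a\<in>Obj SetV. Id VCat (FObj ?D a)) a)))"
      using colim[OF X] by simp
  qed (use nat in \<open>simp_all add: is_vcfun_id\<close>)
qed


section \<open>The diagrams on \<open>N\<close>\<close>

lemma N_cat_simps [simp]:
  "Obj N_cat = UNIV"
  "Hom N_cat x y =
    vdiscrete (if x = y then {u0} else if x \<noteq> Pt \<and> y = Pt then {u0, u1} else {})"
  "Id N_cat x = u0"
  "Comp N_cat x y z g f = (if x = y then g else f)"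
  by (simp_all add: N_cat_def N_ocat_def)

lemma is_vccat_N_cat [simp]: "is_vccat N_cat"
  unfolding N_cat_def
  by (rule is_vccat_free_vccat) (auto simp: N_ocat_def split: if_splits)

lemma small_vcat_N_obj [simp]: "small_vcat (N_obj k)"
  by (cases k) simp_all

text \<open>The codes agree on purpose: \<open>u0\<close> is both the object of \<open>vunit\<close>
  and the identity of \<open>Pt\<close>, and \<open>u0\<close>, \<open>u1\<close> are both the
  objects of \<open>vtwo r\<close> and the two arrows from \<open>Lev r\<close> to
  \<open>Pt\<close>.\<close>

lemma ob_N_obj: "ob (N_obj k) = ob (Hom N_cat k Pt)"
  by (cases k) simp_all

lemma u0_in_N_obj [simp]: "u0 \<in> ob (N_obj k)"
  by (cases k) simp_all

lemma u1_in_N_obj [simp]: "k \<noteq> Pt \<Longrightarrow> u1 \<in> ob (N_obj k)"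
  by (cases k) simp_all

lemma FObj_N_weight [simp]: "FObj N_weight = N_obj"
  by (simp add: N_weight_def)

lemma FMap_N_weight [simp]:
  fixes i :: "'u::set_universe" and x y :: "'v::comm_quantale nob"
  shows "FMap N_weight x y i = (if x = y then lam (ob (N_obj x :: ('u, 'v) vcat)) (\<lambda>z. z)
     else lam {u0} (\<lambda>z. i))"
  by (simp add: N_weight_def)

lemma is_vcfun_N_weight [simp]:
  "is_vcfun (vc_op N_cat) VCat
    (N_weight :: ('v::comm_quantale nob, ('u::set_universe, 'v) vcat, 'u) vcfun)"
proof (rule is_vcfun_discreteI)
  have hom: "lam {u0} (\<lambda>z. i) \<in> ob (vhom vunit (vtwo r :: ('u, 'v) vcat))"
    if "i \<in> {u0, u1}" for i r
    using that
    by (auto simp: vunit_def ob_vhom_vdiscrete small_vcat_is_vcat intro!: exI[of _ "\<lambda>z. i"])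
  fix x y :: "'v nob" and i :: 'u
  assume "i \<in> (if x = y then {u0} else if y \<noteq> Pt \<and> x = Pt then {u0, u1} else {})"
  then show "FMap N_weight x y i
      \<in> ob (Hom VCat (FObj N_weight x) (FObj N_weight y) :: ('u, 'v) vcat)"
    using hom vhom_id[of "N_obj x :: ('u, 'v) vcat"] by (cases x; cases y) (auto split: if_splits)
qed (auto simp: lam_eq_iff split: if_splits)

text \<open>
  The object set of \<open>N k\<close> is that of \<open>Hom N_cat k Pt\<close>, so by the Yoneda lemma a natural
  transformation out of \<open>N\<close> is determined by its value at the object of \<open>N Pt\<close>.
\<close>

definition N_cocone ::
  "('p, 'u::set_universe, 'v::comm_quantale) vccat \<Rightarrow> ('v nob, 'p, 'u) vcfun \<Rightarrow> 'p \<Rightarrow> 'u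
    \<Rightarrow> 'v nob \<Rightarrow> 'u" where
  "N_cocone B P b f = (\<lambda>k. lam (ob (N_obj k :: ('u, 'v) vcat))
    (\<lambda>i. Comp B (FObj P k) (FObj P Pt) b f (FMap P k Pt i)))"

text \<open>Naturality alone determines a cocone on objects from \<open>f\<close>. What is left is
  that its component at \<open>Lev r\<close> respects the distance \<open>r\<close> from
  \<open>u0\<close> to \<open>u1\<close> in \<open>vtwo r\<close>.\<close>

definition N_compatible ::
  "('p, 'u::set_universe, 'v::comm_quantale) vccat \<Rightarrow> ('v nob, 'p, 'u) vcfun \<Rightarrow> 'p \<Rightarrow> 'u \<Rightarrow> bool"
  where
  "N_compatible B P b f \<longleftrightarrow> f \<in> ob (Hom B (FObj P Pt) b) \<and>
    (\<forall>r. r \<le> dist (Hom B (FObj P (Lev r)) b)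
      (Comp B (FObj P (Lev r)) (FObj P Pt) b f (FMap P (Lev r) Pt u0))
      (Comp B (FObj P (Lev r)) (FObj P Pt) b f (FMap P (Lev r) Pt u1)))"

text \<open>\<open>P\<close> sends the identity of \<open>Pt\<close> to an identity, so evaluation
  there recovers \<open>f\<close>: one half of the Yoneda bijection.\<close>

lemma N_cocone_Pt:
  assumes P: "is_vcfun N_cat B P" and b: "b \<in> Obj B" and f: "f \<in> ob (Hom B (FObj P Pt) b)"
  shows "app (N_cocone B P b f Pt) u0 = f"
  using is_vcfun_Id[OF P, of Pt] is_vccat_id_right[OF is_vcfun_cod[OF P] is_vcfun_FObj[OF P] b f]
  by (simp add: N_cocone_def)

text \<open>The arrow belonging to \<open>\<alpha>\<close> is \<open>app (\<alpha> Pt) u0\<close>.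
  V-functoriality of \<open>\<alpha> (Lev r)\<close> on the pair \<open>u0\<close>,
  \<open>u1\<close> is its compatibility at \<open>r\<close>.\<close>

lemma nat_trans_N_iff:
  fixes B :: "('p, 'u::set_universe, 'v::comm_quantale) vccat"
  assumes P: "is_vcfun N_cat B P" and b: "b \<in> Obj B"
  shows "\<alpha> \<in> nat_trans (vc_op N_cat) VCat N_weight (hom_along B P b) \<longleftrightarrow>
    (\<exists>f. N_compatible B P b f \<and> \<alpha> = N_cocone B P b f)"
    (is "?L \<longleftrightarrow> ?R")
proof -
  note B = is_vcfun_cod[OF P]
  have PO: "FObj P k \<in> Obj B" for k
    by (rule is_vcfun_FObj[OF P]) simp
  have PM: "FMap P k Pt i \<in> ob (Hom B (FObj P k) (FObj P Pt))" if "i \<in> ob (N_obj k :: ('u, 'v) vcat)" for k i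
    using is_vcfun_FMap[OF P, of k Pt i] that by (cases k) auto
  note iff = nat_trans_hom_along_iff[OF is_vcfun_N_weight P b]
  show ?thesis
  proof
    assume ?L
    then have \<alpha>: "\<alpha> k \<in> ob (vhom (N_obj k) (Hom B (FObj P k) b))" for k
      by (simp add: iff)
    have nat: "app (\<alpha> j) (app (FMap N_weight k j i) w) =
        Comp B (FObj P j) (FObj P k) b (app (\<alpha> k) w) (FMap P j k i)"
      if "i \<in> ob (Hom (N_cat :: ('v nob, 'u, 'v) vccat) j k)" "w \<in> ob (N_obj k :: ('u, 'v) vcat)" for j k i w
      using \<open>?L\<close> that by (simp add: iff del: FMap_N_weight N_cat_simps(2))
    define f where "f = app (\<alpha> Pt) u0"
    have f: "f \<in> ob (Hom B (FObj P Pt) b)"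
      unfolding f_def using vhom_app[OF _ \<alpha>, of Pt u0] by simp
    \<comment> \<open>The weight turns the arrow \<open>i\<close> into the functor picking
      \<open>i\<close>, so naturality along \<open>i\<close> at \<open>u0\<close> computes the
      component at \<open>i\<close>.\<close>
    have app: "app (\<alpha> k) i = Comp B (FObj P k) (FObj P Pt) b f (FMap P k Pt i)"
      if "i \<in> ob (N_obj k :: ('u, 'v) vcat)" for k i
      using nat[of i k Pt u0] that by (cases k) (auto simp: f_def)
    have "r \<le> dist (Hom B (FObj P (Lev r)) b) (app (\<alpha> (Lev r)) u0) (app (\<alpha> (Lev r)) u1)" for r
      using vfunctor_dist[OF vhom_vfunctor[OF _ \<alpha>[of "Lev r"]], of u0 u1]
      by (simp add: dist_vtwo)
    then have "N_compatible B P b f"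
      using f by (simp add: N_compatible_def app)
    moreover have "\<alpha> = N_cocone B P b f"
    proof
      fix k
      have "N_cocone B P b f k = lam (ob (N_obj k)) (app (\<alpha> k))"
        unfolding N_cocone_def by (rule lam_cong) (simp_all add: app)
      also have "\<dots> = \<alpha> k"
        using vhom_eta[OF _ \<alpha>] by simp
      finally show "\<alpha> k = N_cocone B P b f k"
        by simp
    qed
    ultimately show ?R
      by blast
  next
    assume ?R
    then obtain f where compat: "N_compatible B P b f" and \<alpha>: "\<alpha> = N_cocone B P b f"
      by blast
    have f: "f \<in> ob (Hom B (FObj P Pt) b)"
      and fd: "r \<le> dist (Hom B (FObj P (Lev r)) b)
        (Comp B (FObj P (Lev r)) (FObj P Pt) b f (FMap P (Lev r) Pt u0))
        (Comp B (FObj P (Lev r)) (FObj P Pt) b f (FMap P (Lev r) Pt u1))" for r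
      using compat by (auto simp: N_compatible_def)
    have mem: "Comp B (FObj P k) (FObj P Pt) b f (FMap P k Pt i) \<in> ob (Hom B (FObj P k) b)"
      if "i \<in> ob (N_obj k :: ('u, 'v) vcat)" for k i
      using that by (intro is_vccat_comp[OF B PO PO b PM f])
    have "vfunctor (N_obj k :: ('u, 'v) vcat) (Hom B (FObj P k) b)
        (\<lambda>i. Comp B (FObj P k) (FObj P Pt) b f (FMap P k Pt i))" for k
    proof (rule vfunctorI)
      fix i' i assume i: "i' \<in> ob (N_obj k :: ('u, 'v) vcat)" "i \<in> ob (N_obj k :: ('u, 'v) vcat)"
      have refl: "1 \<le> dist (Hom B (FObj P k) b) h h" if "h \<in> ob (Hom B (FObj P k) b)" for h
        using that small_vcat_is_vcat[OF is_vccat_hom[OF B PO b]] by (rule is_vcat_refl[rotated])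
      \<comment> \<open>The distance from \<open>u0\<close> to \<open>u1\<close> in
        \<open>vtwo r\<close> is bounded by compatibility; the others are \<open>1\<close>, bounded
        by reflexivity, or \<open>bot\<close>.\<close>
      show "dist (N_obj k :: ('u, 'v) vcat) i' i \<le> dist (Hom B (FObj P k) b)
          (Comp B (FObj P k) (FObj P Pt) b f (FMap P k Pt i'))
          (Comp B (FObj P k) (FObj P Pt) b f (FMap P k Pt i))"
        using i mem[OF i(1)] mem[OF i(2)] refl fd
        by (cases k) (auto simp: dist_vtwo vunit_def dist_vdiscrete)
    qed (rule mem)
    then have hom: "\<alpha> k \<in> ob (vhom (N_obj k) (Hom B (FObj P k) b))" for k
      unfolding \<alpha> N_cocone_def by (rule vhom_lam)
    have app: "app (\<alpha> k) i = Comp B (FObj P k) (FObj P Pt) b f (FMap P k Pt i)"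
      if "i \<in> ob (N_obj k :: ('u, 'v) vcat)" for k i
      using that by (simp add: \<alpha> N_cocone_def)
    have nat: "app (\<alpha> j) (app (FMap N_weight k j i) w) =
        Comp B (FObj P j) (FObj P k) b (app (\<alpha> k) w) (FMap P j k i)"
      if i: "i \<in> ob (Hom (N_cat :: ('v nob, 'u, 'v) vccat) j k)"
        and w: "w \<in> ob (N_obj k :: ('u, 'v) vcat)" for j k i w
    proof -
      have wk: "w \<in> ob (Hom (N_cat :: ('v nob, 'u, 'v) vccat) k Pt)"
        using w by (simp only: ob_N_obj)
      \<comment> \<open>On objects the weight is the representable of \<open>Pt\<close>: it acts by
        composition in \<open>N_cat\<close>, and naturality becomes functoriality of
        \<open>P\<close> with associativity in \<open>B\<close>.\<close>
      have "app (FMap N_weight k j i) w = Comp (N_cat :: ('v nob, 'u, 'v) vccat) j k Pt w i"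
        using i w by (cases k; cases j) (auto split: if_splits)
      moreover have "Comp (N_cat :: ('v nob, 'u, 'v) vccat) j k Pt w i \<in> ob (N_obj j :: ('u, 'v) vcat)"
        unfolding ob_N_obj by (rule is_vccat_comp[OF is_vccat_N_cat _ _ _ i wk]) simp_all
      ultimately have "app (\<alpha> j) (app (FMap N_weight k j i) w) =
          Comp B (FObj P j) (FObj P Pt) b f (FMap P j Pt (Comp (N_cat :: ('v nob, 'u, 'v) vccat) j k Pt w i))"
        by (simp only: app)
      also have "FMap P j Pt (Comp (N_cat :: ('v nob, 'u, 'v) vccat) j k Pt w i) =
          Comp B (FObj P j) (FObj P k) (FObj P Pt) (FMap P k Pt w) (FMap P j k i)"
        by (rule is_vcfun_Comp[OF P _ _ _ i wk]) simp_all
      also have "Comp B (FObj P j) (FObj P Pt) b f \<dots> =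
          Comp B (FObj P j) (FObj P k) b (app (\<alpha> k) w) (FMap P j k i)"
        unfolding app[OF w]
        by (rule is_vccat_assoc[OF B PO PO PO b is_vcfun_FMap[OF P _ _ i] PM[OF w] f, symmetric])
          simp_all
      finally show ?thesis .
    qed
    then show ?L
      using hom by (simp add: iff del: FMap_N_weight N_cat_simps(2))
  qed
qed

lemma N_cocone_nat_trans:
  assumes P: "is_vcfun N_cat B P" and b: "b \<in> Obj B" and f: "N_compatible B P b f"
  shows "N_cocone B P b f \<in> nat_trans (vc_op N_cat) VCat N_weight (hom_along B P b)"
  using f by (auto simp: nat_trans_N_iff[OF P b])

text \<open>The infimum over \<open>k\<close> is attained at \<open>Pt\<close>: the other components
  arise by precomposition, which does not decrease distances.\<close>

lemma dist_N_cocone: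
  fixes B :: "('p, 'u::set_universe, 'v::comm_quantale) vccat"
  assumes P: "is_vcfun N_cat B P" and b: "b \<in> Obj B"
    and f: "N_compatible B P b f" and g: "N_compatible B P b g"
  shows "dist (nat_vcat (vc_op N_cat) VCat N_weight (hom_along B P b))
      (N_cocone B P b f) (N_cocone B P b g) = dist (Hom B (FObj P Pt) b) f g"
proof -
  note B = is_vcfun_cod[OF P]
  have PO: "FObj P k \<in> Obj B" for k
    by (rule is_vcfun_FObj[OF P]) simp
  have PM: "FMap P k Pt i \<in> ob (Hom B (FObj P k) (FObj P Pt))" if "i \<in> ob (N_obj k :: ('u, 'v) vcat)" for k i
    using is_vcfun_FMap[OF P, of k Pt i] that by (cases k) auto
  note nat = N_cocone_nat_trans[OF P b f] N_cocone_nat_trans[OF P b g]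
  have fg: "f \<in> ob (Hom B (FObj P Pt) b)" "g \<in> ob (Hom B (FObj P Pt) b)"
    using f g by (auto simp: N_compatible_def)
  have hom: "N_cocone B P b f k \<in> ob (vhom (N_obj k) (Hom B (FObj P k) b))"
    "N_cocone B P b g k \<in> ob (vhom (N_obj k) (Hom B (FObj P k) b))" for k
    using nat by (simp_all add: nat_trans_hom_along_iff[OF is_vcfun_N_weight P b])
  have eq: "dist (nat_vcat (vc_op N_cat) VCat N_weight (hom_along B P b))
      (N_cocone B P b f) (N_cocone B P b g) =
    (INF k. dist (vhom (N_obj k) (Hom B (FObj P k) b)) (N_cocone B P b f k) (N_cocone B P b g k))"
    using nat by (simp add: dist_nat_vcat)
  show ?thesis
    unfolding eq
  proof (rule antisym)
    have "(INF k. dist (vhom (N_obj k) (Hom B (FObj P k) b)) (N_cocone B P b f k) (N_cocone B P b g k))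
        \<le> dist (vhom (N_obj Pt) (Hom B (FObj P Pt) b)) (N_cocone B P b f Pt) (N_cocone B P b g Pt)"
      by (rule INF_lower) simp
    also have "\<dots> \<le> dist (Hom B (FObj P Pt) b) (app (N_cocone B P b f Pt) u0) (app (N_cocone B P b g Pt) u0)"
      by (rule dist_vhom_le[OF hom]) simp
    also have "\<dots> = dist (Hom B (FObj P Pt) b) f g"
      by (simp only: N_cocone_Pt[OF P b] fg)
    finally show "(INF k. dist (vhom (N_obj k) (Hom B (FObj P k) b))
      (N_cocone B P b f k) (N_cocone B P b g k)) \<le> dist (Hom B (FObj P Pt) b) f g" .
    have "dist (Hom B (FObj P Pt) b) f g \<le> dist (vhom (N_obj k) (Hom B (FObj P k) b))
      (N_cocone B P b f k) (N_cocone B P b g k)" for k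
      unfolding dist_vhom[OF hom]
      by (rule INF_greatest)
        (simp add: N_cocone_def is_vccat_whisker_right[OF B PO PO b PM fg])
    then show "dist (Hom B (FObj P Pt) b) f g \<le>
        (INF k. dist (vhom (N_obj k) (Hom B (FObj P k) b)) (N_cocone B P b f k) (N_cocone B P b g k))"
      by (rule INF_greatest)
  qed
qed

text \<open>This is associativity in \<open>B\<close>. It turns the comparison of cocones into
  composition with the single arrow \<open>\<phi>\<close>.\<close>

lemma cocone_comp_N_cocone:
  fixes B :: "('p, 'u::set_universe, 'v::comm_quantale) vccat"
  assumes P: "is_vcfun N_cat B P" and C: "C \<in> Obj B" and b: "b \<in> Obj B"
    and \<phi>: "\<phi> \<in> ob (Hom B (FObj P Pt) C)" and f: "f \<in> ob (Hom B C b)"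
  shows "cocone_comp N_cat B N_weight P C b f (N_cocone B P C \<phi>) =
    N_cocone B P b (Comp B (FObj P Pt) C b f \<phi>)"
proof
  fix k
  note B = is_vcfun_cod[OF P]
  have PO: "FObj P k \<in> Obj B" for k
    by (rule is_vcfun_FObj[OF P]) simp
  have PM: "FMap P k Pt i \<in> ob (Hom B (FObj P k) (FObj P Pt))" if "i \<in> ob (N_obj k :: ('u, 'v) vcat)" for i
    using is_vcfun_FMap[OF P, of k Pt i] that by (cases k) auto
  show "cocone_comp N_cat B N_weight P C b f (N_cocone B P C \<phi>) k =
    N_cocone B P b (Comp B (FObj P Pt) C b f \<phi>) k"
    using is_vccat_assoc[OF B PO PO C b PM \<phi> f]
    by (simp add: cocone_comp_def N_cocone_def lam_eq_iff)
qed

text \<open>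
  A compatible \<open>g\<close> factors through \<open>\<phi>\<close>: its compatibility at the level \<open>r = dist C x' x\<close> says
  that the factor does not decrease the distance from \<open>x'\<close> to \<open>x\<close>.
\<close>

lemma N_colimitI:
  fixes C :: "('u::set_universe, 'v::comm_quantale) vcat"
  assumes P: "is_vcfun N_cat VCat P" and G: "\<And>k. FObj P k = vdiscrete (G k)"
    and C: "small_vcat C"
    and \<mu>: "\<mu> \<in> nat_trans (vc_op N_cat) VCat N_weight (hom_along VCat P C)"
    and \<phi>: "\<phi> = app (\<mu> Pt) u0"
    and bij: "bij_betw (app \<phi>) (G Pt) (ob C)"
    and wit: "\<And>x' x. x' \<in> ob C \<Longrightarrow> x \<in> ob C \<Longrightarrow> \<exists>p\<in>G (Lev (dist C x' x)).
      app \<phi> (app (FMap P (Lev (dist C x' x)) Pt u0) p) = x' \<and>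
      app \<phi> (app (FMap P (Lev (dist C x' x)) Pt u1) p) = x"
  shows "is_weighted_colimit N_cat VCat N_weight P C \<mu>"
proof -
  have CO: "C \<in> Obj VCat"
    using C by simp
  have PO: "FObj P k \<in> Obj VCat" for k
    by (rule is_vcfun_FObj[OF P]) simp
  have Gsmall: "small (G k)" for k
    using PO[of k] by (simp add: G small_vcat_def)
  have \<phi>_compat: "N_compatible VCat P C \<phi>" and \<mu>_eq: "\<mu> = N_cocone VCat P C \<phi>"
    using \<mu> N_cocone_Pt[OF P CO] by (auto simp: nat_trans_N_iff[OF P CO] \<phi> N_compatible_def)
  have \<phi>_hom: "\<phi> \<in> ob (vhom (vdiscrete (G Pt)) C)"
    using \<phi>_compat by (simp add: N_compatible_def G)
  have PM: "FMap P (Lev r) Pt i \<in> ob (vhom (vdiscrete (G (Lev r))) (vdiscrete (G Pt)) :: ('u, 'v) vcat)"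
    if "i \<in> {u0, u1}" for r i
    using is_vcfun_FMap[OF P, of "Lev r" Pt i] that by (auto simp: G)
  have PM_app: "app (FMap P (Lev r) Pt i) p \<in> G Pt" if "i \<in> {u0, u1}" "p \<in> G (Lev r)" for r i p
    using vhom_app[OF _ PM[OF that(1)], where y = p] that Gsmall by simp
  have \<phi>_app: "app \<phi> y \<in> ob C" if "y \<in> G Pt" for y
    using bij that by (auto simp: bij_betw_def)
  have "vcat_iso (Hom VCat C b) (nat_vcat (vc_op N_cat) VCat N_weight (hom_along VCat P b))
      (\<lambda>f. cocone_comp N_cat VCat N_weight P C b f \<mu>)" (is "vcat_iso _ ?N ?\<Phi>")
    if bO: "b \<in> Obj VCat" for b
  proof -
    have b: "small_vcat b"
      using bO by simp
    let ?c = "\<lambda>f. Comp VCat (FObj P Pt) C b f \<phi>"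
    have c: "?c f = lam (G Pt) (\<lambda>y. app f (app \<phi> y))" for f
      by (simp add: G)
    have \<Phi>: "?\<Phi> f = N_cocone VCat P b (?c f)" if "f \<in> ob (vhom C b)" for f
      unfolding \<mu>_eq using that \<phi>_hom by (intro cocone_comp_N_cocone[OF P CO bO]) (auto simp: G)
    have \<Phi>_nat: "?\<Phi> f \<in> nat_trans (vc_op N_cat) VCat N_weight (hom_along VCat P b)"
      if "f \<in> ob (vhom C b)" for f
      using that by (intro cocone_comp_nat_trans[OF is_vcfun_N_weight P CO bO \<mu>]) simp
    have c_hom: "?c f \<in> ob (Hom VCat (FObj P Pt) b)" if "f \<in> ob (vhom C b)" for f
      using that \<phi>_hom by (intro is_vccat_comp[OF is_vccat_VCat PO CO bO]) (auto simp: G)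
    have compat: "N_compatible VCat P b (?c f)" if f: "f \<in> ob (vhom C b)" for f
    proof -
      \<comment> \<open>Compatibility of \<open>?c f\<close> is read off from naturality of
        \<open>?\<Phi> f\<close>: the latter is the cocone of some compatible \<open>g\<close>, and
        evaluation at \<open>Pt\<close> gives \<open>g = ?c f\<close>.\<close>
      obtain g where g: "N_compatible VCat P b g" "?\<Phi> f = N_cocone VCat P b g"
        using \<Phi>_nat[OF f] by (auto simp: nat_trans_N_iff[OF P bO])
      then have "g = app (N_cocone VCat P b (?c f) Pt) u0"
        using N_cocone_Pt[OF P bO, of g] \<Phi>[OF f] by (simp add: N_compatible_def)
      then show ?thesis
        using g N_cocone_Pt[OF P bO c_hom[OF f]] by simp
    qed
    have c_inj: "f = f'" if "f \<in> ob (vhom C b)" "f' \<in> ob (vhom C b)" "?c f = ?c f'" for f f'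
    proof (rule vhom_ext[OF _ that(1,2)])
      fix x assume "x \<in> ob C"
      then obtain y where "y \<in> G Pt" "x = app \<phi> y"
        using bij by (auto simp: bij_betw_def)
      then show "app f x = app f' x"
        using that(3) by (simp add: G lam_eq_iff Gsmall)
    qed (use C in simp)
    have surj: "\<exists>f\<in>ob (vhom C b). ?c f = g" if g: "N_compatible VCat P b g" for g
    proof -
      have g_hom: "g \<in> ob (vhom (vdiscrete (G Pt)) b)"
        using g by (simp add: N_compatible_def G)
      \<comment> \<open>Since \<open>app \<phi>\<close> is bijective on objects, the factor of
        \<open>g\<close> has to be \<open>g\<close> after this inverse.\<close>
      let ?\<psi> = "inv_into (G Pt) (app \<phi>)"
      have \<psi>: "?\<psi> (app \<phi> y) = y" if "y \<in> G Pt" for y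
        using bij that by (simp add: bij_betw_def)
      have "vfunctor C b (\<lambda>x. app g (?\<psi> x))"
      proof (rule vfunctorI)
        fix x assume "x \<in> ob C"
        then have "?\<psi> x \<in> G Pt"
          using bij by (auto simp: bij_betw_def inv_into_into)
        then show "app g (?\<psi> x) \<in> ob b"
          using vhom_app[OF _ g_hom] Gsmall by simp
      next
        fix x' x assume x: "x' \<in> ob C" "x \<in> ob C"
        define r where "r = dist C x' x"
        obtain p where p: "p \<in> G (Lev r)"
          and px: "app \<phi> (app (FMap P (Lev r) Pt u0) p) = x'" "app \<phi> (app (FMap P (Lev r) Pt u1) p) = x"
          using wit[OF x] unfolding r_def by blast
        have mem: "Comp VCat (FObj P (Lev r)) (FObj P Pt) b g (FMap P (Lev r) Pt i)
            \<in> ob (vhom (vdiscrete (G (Lev r))) b)" if "i \<in> {u0, u1}" for i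
          using is_vccat_comp[OF is_vccat_VCat PO PO bO, of _ "Lev r" Pt g] PM[OF that] g_hom
          by (simp add: G)
        have "r \<le> dist (vhom (vdiscrete (G (Lev r))) b)
            (Comp VCat (FObj P (Lev r)) (FObj P Pt) b g (FMap P (Lev r) Pt u0))
            (Comp VCat (FObj P (Lev r)) (FObj P Pt) b g (FMap P (Lev r) Pt u1))"
          using g unfolding N_compatible_def G VCat_simps(2) by blast
        also have "\<dots> \<le> dist b
            (app (Comp VCat (FObj P (Lev r)) (FObj P Pt) b g (FMap P (Lev r) Pt u0)) p)
            (app (Comp VCat (FObj P (Lev r)) (FObj P Pt) b g (FMap P (Lev r) Pt u1)) p)"
          by (rule dist_vhom_le) (use mem p in auto)
        also have "\<dots> = dist b (app g (app (FMap P (Lev r) Pt u0) p)) (app g (app (FMap P (Lev r) Pt u1) p))"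
          using p by (simp add: G Gsmall)
        also have "\<dots> = dist b (app g (?\<psi> x')) (app g (?\<psi> x))"
          unfolding px[symmetric] using \<psi>[OF PM_app[OF _ p]] by simp
        finally show "dist C x' x \<le> dist b (app g (?\<psi> x')) (app g (?\<psi> x))"
          unfolding r_def .
      qed
      moreover have "?c (lam (ob C) (\<lambda>x. app g (?\<psi> x))) = g"
      proof -
        have "?c (lam (ob C) (\<lambda>x. app g (?\<psi> x))) = lam (G Pt) (app g)"
          unfolding c using C by (simp add: lam_eq_iff Gsmall \<phi>_app \<psi>)
        also have "\<dots> = g"
          using vhom_eta[OF _ g_hom] Gsmall by simp
        finally show ?thesis .
      qed
      ultimately show ?thesis
        by (intro bexI[of _ "lam (ob C) (\<lambda>x. app g (?\<psi> x))"] vhom_lam)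
    qed
    have "bij_betw ?\<Phi> (ob (vhom C b)) (ob ?N)"
      unfolding bij_betw_def
    proof (intro conjI inj_onI set_eqI iffI)
      fix f f' assume f: "f \<in> ob (vhom C b)" "f' \<in> ob (vhom C b)" "?\<Phi> f = ?\<Phi> f'"
      have "N_cocone VCat P b (?c f) = N_cocone VCat P b (?c f')"
        using f(3) unfolding \<Phi>[OF f(1)] \<Phi>[OF f(2)] .
      then have "app (N_cocone VCat P b (?c f) Pt) u0 = app (N_cocone VCat P b (?c f') Pt) u0"
        by (rule arg_cong[where f = "\<lambda>\<alpha>. app (\<alpha> Pt) u0"])
      then have "?c f = ?c f'"
        unfolding N_cocone_Pt[OF P bO c_hom[OF f(1)]] N_cocone_Pt[OF P bO c_hom[OF f(2)]] .
      then show "f = f'"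
        using c_inj f by blast
    next
      fix \<alpha> assume "\<alpha> \<in> ob ?N"
      then obtain g where \<alpha>: "N_compatible VCat P b g" "\<alpha> = N_cocone VCat P b g"
        by (auto simp: nat_trans_N_iff[OF P bO])
      obtain f where f: "f \<in> ob (vhom C b)" "?c f = g"
        using surj[OF \<alpha>(1)] by blast
      then have "?\<Phi> f = \<alpha>"
        using \<alpha>(2) \<Phi>[OF f(1)] by simp
      then show "\<alpha> \<in> ?\<Phi> ` ob (vhom C b)"
        using f(1) by blast
    qed (use \<Phi>_nat in auto)
    moreover have "dist (vhom C b) f f' = dist ?N (?\<Phi> f) (?\<Phi> f')"
      if f: "f \<in> ob (vhom C b)" "f' \<in> ob (vhom C b)" for f f'
    proof -
      have hom: "?c f \<in> ob (vhom (vdiscrete (G Pt)) b)" "?c f' \<in> ob (vhom (vdiscrete (G Pt)) b)"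
        using c_hom[OF f(1)] c_hom[OF f(2)] by (simp_all add: G)
      have "dist ?N (?\<Phi> f) (?\<Phi> f') = dist (vhom (vdiscrete (G Pt)) b) (?c f) (?c f')"
        using dist_N_cocone[OF P bO compat[OF f(1)] compat[OF f(2)]] f by (simp add: \<Phi> G)
      also have "\<dots> = (INF y\<in>G Pt. dist b (app f (app \<phi> y)) (app f' (app \<phi> y)))"
        unfolding dist_vhom[OF hom] by (simp add: G Gsmall cong: INF_cong_simp)
      \<comment> \<open>Reindexing along the surjection \<open>app \<phi>\<close>.\<close>
      also have "\<dots> = (INF x\<in>ob C. dist b (app f x) (app f' x))"
        unfolding bij_betw_imp_surj_on[OF bij, symmetric] by (simp add: image_image)
      also have "\<dots> = dist (vhom C b) f f'"
        by (simp add: dist_vhom f)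
      finally show ?thesis
        by simp
    qed
    ultimately show ?thesis
      by (simp add: vcat_iso_iff)
  qed
  then show ?thesis
    using P CO \<mu> by (simp add: is_weighted_colimit_iff)
qed


section \<open>The density presentation\<close>

lemma F_fun_simps [simp]:
  "FObj (F_fun X) = F_obj X"
  "FMap (F_fun X) x y i = lam (elts (F_obj X x))
     (if x = y then (\<lambda>z. z) else if i = u0 then pfst else psnd)"
  by (simp_all add: F_fun_def)

lemma elts_F_obj_Pt [simp]: "small_vcat X \<Longrightarrow> elts (F_obj X Pt) = ob X"
  by simp

lemma elts_F_obj_Lev [simp]:
  assumes "small_vcat X"
  shows "elts (F_obj X (Lev r)) = {pair x' x | x' x. x' \<in> ob X \<and> x \<in> ob X \<and> r \<le> dist X x' x}"
proof -
  have "small {pair x' x | x' x. x' \<in> ob X \<and> x \<in> ob X \<and> r \<le> dist X x' x}"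
    by (rule small_subset[OF small_pairs[of "ob X" "ob X"]]) (use assms in auto)
  then show ?thesis
    by simp
qed

declare F_obj.simps [simp del]

lemma is_vcfun_F_fun:
  fixes X :: "('u::set_universe, 'v::comm_quantale) vcat"
  assumes X: "small_vcat X"
  shows "is_vcfun N_cat (SetV :: ('u, 'u, 'v) vccat) (F_fun X)"
proof (rule is_vcfun_discreteI)
  fix x y :: "'v nob" and i :: 'u
  assume i: "i \<in> (if x = y then {u0} else if x \<noteq> Pt \<and> y = Pt then {u0, u1} else {})"
  have "(if x = y then (\<lambda>z. z) else if i = u0 then pfst else psnd) ` elts (F_obj X x)
      \<subseteq> elts (F_obj X y)"
    using i X by (cases x; cases y) (auto split: if_splits)
  then show "FMap (F_fun X) x y i \<in> ob (Hom (SetV :: ('u, 'u, 'v) vccat) (FObj (F_fun X) x) (FObj (F_fun X) y))"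
    unfolding F_fun_simps SetV_simps ob_vdiscrete by blast
next
  fix x y z :: "'v nob" and i j :: 'u
  assume i: "i \<in> (if x = y then {u0} else if x \<noteq> Pt \<and> y = Pt then {u0, u1} else {})"
    and j: "j \<in> (if y = z then {u0} else if y \<noteq> Pt \<and> z = Pt then {u0, u1} else {})"
  have proj: "pfst p \<in> elts (F_obj X Pt)" "psnd p \<in> elts (F_obj X Pt)"
    if "p \<in> elts (F_obj X (Lev r))" for p r
    using that X by auto
  show "FMap (F_fun X) x z (Comp N_cat x y z j i) =
      Comp (SetV :: ('u, 'u, 'v) vccat) (FObj (F_fun X) x) (FObj (F_fun X) y) (FObj (F_fun X) z)
        (FMap (F_fun X) y z j) (FMap (F_fun X) x y i)"
    using i j proj
    by (cases x; cases y; cases z)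
      (auto simp: lam_eq_iff simp del: elts_F_obj_Pt elts_F_obj_Lev split: if_splits)
qed simp_all

lemma is_vcfun_D_F_fun:
  "small_vcat X \<Longrightarrow> is_vcfun N_cat VCat (vcfun_comp D_fun (F_fun X))"
  by (rule is_vcfun_comp[OF is_vcfun_F_fun is_vcfun_D_fun])

text \<open>The identity of \<open>ob X\<close> composed with the structure maps gives the two
  projections. They lie at distance at least \<open>r\<close> because level \<open>r\<close>
  consists of pairs at such a distance, so the identity is compatible.\<close>

lemma canonical_colimit:
  fixes X :: "('u::set_universe, 'v::comm_quantale) vcat"
  assumes X: "small_vcat X"
  defines "P \<equiv> vcfun_comp D_fun (F_fun X) :: ('v nob, ('u, 'v) vcat, 'u) vcfun"
  shows "is_weighted_colimit N_cat VCat N_weight P X (N_cocone VCat P X (lam (ob X) (\<lambda>x. x)))"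
proof -
  have P: "is_vcfun N_cat VCat P"
    unfolding P_def using X by (rule is_vcfun_D_F_fun)
  have G: "FObj P k = vdiscrete (elts (F_obj X k))" for k
    by (simp add: P_def)
  have XO: "X \<in> Obj VCat"
    using X by simp
  let ?id = "lam (ob X) (\<lambda>x. x)"
  let ?E = "\<lambda>r. elts (F_obj X (Lev r))"
  have comp: "Comp VCat (FObj P (Lev r)) (FObj P Pt) X ?id (FMap P (Lev r) Pt i) =
      lam (?E r) (if i = u0 then pfst else psnd)" for r i
    using X by (auto simp: P_def lam_eq_iff simp del: elts_F_obj_Lev) (auto simp: X)
  have pr: "lam (?E r) pfst \<in> ob (vhom (vdiscrete (?E r)) X)"
    "lam (?E r) psnd \<in> ob (vhom (vdiscrete (?E r)) X)" for r
    using X unfolding ob_vhom_vdiscrete[OF small_vcat_is_vcat[OF X]] by fastforce+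
  have "r \<le> dist (vhom (vdiscrete (?E r)) X) (lam (?E r) pfst) (lam (?E r) psnd)" for r
    unfolding dist_vhom[OF pr] ob_vdiscrete
  proof (rule INF_greatest)
    fix p assume "p \<in> ?E r"
    moreover from this have "r \<le> dist X (pfst p) (psnd p)"
      using X by auto
    ultimately show "r \<le> dist X (app (lam (?E r) pfst) p) (app (lam (?E r) psnd) p)"
      by (simp del: elts_F_obj_Lev)
  qed
  moreover have id: "?id \<in> ob (Hom VCat (FObj P Pt) X)"
    using X by (auto simp: G ob_vhom_vdiscrete small_vcat_is_vcat)
  ultimately have compat: "N_compatible VCat P X ?id"
    unfolding N_compatible_def comp by (simp add: G del: elts_F_obj_Lev)
  show ?thesis
  proof (rule N_colimitI[OF P G X N_cocone_nat_trans[OF P XO compat]])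
    show "?id = app (N_cocone VCat P X ?id Pt) u0"
      using N_cocone_Pt[OF P XO id] by simp
    show "bij_betw (app ?id) (elts (F_obj X Pt)) (ob X)"
      using X by (simp add: bij_betw_def inj_on_def)
    fix x' x assume x: "x' \<in> ob X" "x \<in> ob X"
    let ?r = "dist X x' x"
    \<comment> \<open>A pair belongs to the level of its own distance, which is the witness asked
      for by \<open>N_colimitI\<close>.\<close>
    have p: "pair x' x \<in> ?E ?r"
      using x X by simp
    have "app (FMap P (Lev ?r) Pt u0) (pair x' x) = x'" "app (FMap P (Lev ?r) Pt u1) (pair x' x) = x"
      using p by (simp_all add: P_def del: elts_F_obj_Lev)
    then show "\<exists>p\<in>?E ?r. app ?id (app (FMap P (Lev ?r) Pt u0) p) = x' \<and>
        app ?id (app (FMap P (Lev ?r) Pt u1) p) = x"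
      using p x X by (intro bexI[of _ "pair x' x"]) (simp_all del: elts_F_obj_Lev)
  qed
qed

text \<open>The isomorphism \<open>h\<close> from the canonical colimit carries the canonical cocone
  to \<open>\<mu>\<close>. As that cocone is the identity at \<open>Pt\<close>, the component of
  \<open>\<mu>\<close> there is \<open>h\<close> itself.\<close>

lemma colimit_cocone:
  fixes X :: "('u::set_universe, 'v::comm_quantale) vcat"
  assumes X: "small_vcat X"
    and col: "is_weighted_colimit N_cat VCat N_weight (vcfun_comp D_fun (F_fun X)) C \<mu>"
  shows "bij_betw (app (app (\<mu> Pt) u0)) (ob X) (ob C)"
    and "x' \<in> ob X \<Longrightarrow> x \<in> ob X \<Longrightarrow>
      dist C (app (app (\<mu> Pt) u0) x') (app (app (\<mu> Pt) u0) x) = dist X x' x"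
proof -
  let ?P = "vcfun_comp D_fun (F_fun X) :: ('v nob, ('u, 'v) vcat, 'u) vcfun"
  let ?id = "lam (ob X) (\<lambda>x. x)"
  note P = is_vcfun_D_F_fun[OF X]
  have XO: "X \<in> Obj VCat" and CO: "C \<in> Obj VCat"
    using X col by (auto simp: is_weighted_colimit_iff)
  obtain h g where h: "h \<in> ob (Hom VCat X C)" and g: "g \<in> ob (Hom VCat C X)"
    and gh: "Comp VCat X C X g h = Id VCat X" and hg: "Comp VCat C X C h g = Id VCat C"
    and \<mu>: "cocone_comp N_cat VCat N_weight ?P X C h (N_cocone VCat ?P X ?id) = \<mu>"
    using weighted_colimit_unique[OF canonical_colimit[OF X] col] .
  have id: "?id \<in> ob (Hom VCat (FObj ?P Pt) X)"
    using X by (auto simp: ob_vhom_vdiscrete small_vcat_is_vcat)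
  have c: "Comp VCat (FObj ?P Pt) X C h ?id \<in> ob (Hom VCat (FObj ?P Pt) C)"
    by (rule is_vccat_comp[OF is_vccat_VCat is_vcfun_FObj[OF P] XO CO id h]) simp
  have "app (\<mu> Pt) u0 = Comp VCat (FObj ?P Pt) X C h ?id"
    unfolding \<mu>[symmetric] cocone_comp_N_cocone[OF P XO CO id h] by (rule N_cocone_Pt[OF P CO c])
  then have app: "app (app (\<mu> Pt) u0) x = app h x" if "x \<in> ob X" for x
    using that X by simp
  have iso: "bij_betw (app h) (ob X) (ob C)"
    "\<And>x' x. x' \<in> ob X \<Longrightarrow> x \<in> ob X \<Longrightarrow> dist C (app h x') (app h x) = dist X x' x"
    using VCat_iso_bij_isometry[OF _ _ _ _ gh hg] XO CO h g by simp_all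
  show "bij_betw (app (app (\<mu> Pt) u0)) (ob X) (ob C)"
    using iso(1) app by (simp cong: bij_betw_cong)
  show "dist C (app (app (\<mu> Pt) u0) x') (app (app (\<mu> Pt) u0) x) = dist X x' x"
    if "x' \<in> ob X" "x \<in> ob X"
    using iso(2) app that by simp
qed

text \<open>Any colimit \<open>C\<close> is a copy of \<open>X\<close> along \<open>\<phi>\<close>,
  so \<open>N_colimitI\<close> can be applied to the image diagram with vertex
  \<open>[DS,C]\<close>. The image cocone at \<open>Pt\<close> is postcomposition with
  \<open>\<phi>\<close>, with inverse postcomposition with \<open>\<psi>\<close>.\<close>

lemma hom_from_D_preserves_colimit:
  fixes X :: "('u::set_universe, 'v::comm_quantale) vcat"
  assumes integral: "(1 :: 'v) = top" and X: "small_vcat X"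
  shows "preserves_colimit N_cat VCat VCat (hom_from VCat (FObj D_fun S)) N_weight
    (vcfun_comp D_fun (F_fun X))"
  unfolding preserves_colimit_def
proof (intro conjI allI impI)
  let ?P = "vcfun_comp D_fun (F_fun X) :: ('v nob, ('u, 'v) vcat, 'u) vcfun"
  let ?S = "FObj D_fun S :: ('u, 'v) vcat"
  let ?H = "hom_from VCat ?S"
  note P = is_vcfun_D_F_fun[OF X]
  show H: "is_vcfun VCat VCat ?H"
    by (rule is_vcfun_hom_from) simp_all
  fix C \<mu> assume col: "is_weighted_colimit N_cat VCat N_weight ?P C \<mu>"
  then have CO: "C \<in> Obj VCat"
    and \<mu>: "\<mu> \<in> nat_trans (vc_op N_cat) VCat N_weight (hom_along VCat ?P C)"
    by (simp_all only: is_weighted_colimit_iff)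
  have C: "small_vcat C"
    using CO by simp
  define \<phi> where "\<phi> = app (\<mu> Pt) u0"
  define \<psi> where "\<psi> = inv_into (ob X) (app \<phi>)"
  have bij: "bij_betw (app \<phi>) (ob X) (ob C)"
    and isom: "\<And>x' x. x' \<in> ob X \<Longrightarrow> x \<in> ob X \<Longrightarrow> dist C (app \<phi> x') (app \<phi> x) = dist X x' x"
    unfolding \<phi>_def by (fact colimit_cocone[OF X col])+
  have \<psi>: "\<psi> y \<in> ob X" "app \<phi> (\<psi> y) = y" if "y \<in> ob C" for y
    using bij_betw_imp_surj_on[OF bij] that unfolding \<psi>_def
    by (simp_all add: inv_into_into f_inv_into_f)
  define G where "G k = {lam (elts S) f | f. f ` elts S \<subseteq> elts (F_obj X k)}" for k
  \<comment> \<open>Integrality enters here: the values of the image diagram have to be discrete for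
    the criterion to apply.\<close>
  have G: "FObj (vcfun_comp ?H ?P) k = vdiscrete (G k)" for k
    by (simp add: G_def vhom_vdiscrete[OF integral])
  have Gsmall: "small (G k)" for k
    by (simp add: G_def small_maps)
  have GI: "lam (elts S) f \<in> G k" if "\<And>s. s \<in> elts S \<Longrightarrow> f s \<in> elts (F_obj X k)" for f k
    using that unfolding G_def by blast
  have G_app: "app g s \<in> elts (F_obj X k)" if "g \<in> G k" "s \<in> elts S" for g s k
    using that by (auto simp: G_def)
  have G_eta: "lam (elts S) (app g) = g" if "g \<in> G k" for g k
    using that by (auto simp: G_def lam_eq_iff)
  let ?\<nu> = "\<lambda>k\<in>Obj (N_cat :: ('v nob, 'u, 'v) vccat). lam (ob (FObj N_weight k)) (\<lambda>w. FMap ?H (FObj ?P k) C (app (\<mu> k) w))"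
  have \<nu>: "?\<nu> \<in> nat_trans (vc_op N_cat) VCat N_weight (hom_along VCat (vcfun_comp ?H ?P) (FObj ?H C))"
    by (rule nat_trans_preserved[OF is_vcfun_N_weight P CO H \<mu>])
  have \<nu>_Pt: "app (?\<nu> Pt) u0 = lam (G Pt) (\<lambda>g. lam (elts S) (\<lambda>s. app \<phi> (app g s)))"
    using G[of Pt] by (simp add: \<phi>_def)
  have \<nu>_app: "app (app (?\<nu> Pt) u0) g = lam (elts S) (\<lambda>s. app \<phi> (app g s))" if "g \<in> G Pt" for g
    unfolding \<nu>_Pt using that by (simp add: Gsmall)
  have hom_C: "ob (FObj ?H C) = {lam (elts S) f | f. f ` elts S \<subseteq> ob C}"
    using C by (simp add: ob_vhom_vdiscrete small_vcat_is_vcat)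
  have hom_C_app: "app f s \<in> ob C" if "f \<in> ob (FObj ?H C)" "s \<in> elts S" for f s
    using that unfolding hom_C by auto
  have hom_C_eta: "lam (elts S) (app f) = f" if "f \<in> ob (FObj ?H C)" for f
    using that unfolding hom_C by (auto simp: lam_eq_iff)
  have \<nu>_\<psi>: "app (app (?\<nu> Pt) u0) (lam (elts S) (\<lambda>s. \<psi> (app f s))) = f"
    if f: "f \<in> ob (FObj ?H C)" for f
  proof -
    have "lam (elts S) (\<lambda>s. \<psi> (app f s)) \<in> G Pt"
      using X \<psi> hom_C_app[OF f] by (intro GI) simp
    then have "app (app (?\<nu> Pt) u0) (lam (elts S) (\<lambda>s. \<psi> (app f s))) = lam (elts S) (app f)"
      using \<psi> hom_C_app[OF f] by (subst \<nu>_app) (simp_all add: lam_eq_iff)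
    then show ?thesis
      using hom_C_eta[OF f] by simp
  qed
  show "is_weighted_colimit N_cat VCat N_weight (vcfun_comp ?H ?P) (FObj ?H C) ?\<nu>"
  proof (rule N_colimitI[OF is_vcfun_comp[OF P H] G _ \<nu> refl])
    show "small_vcat (FObj ?H C)"
      using C by simp
    show "bij_betw (app (app (?\<nu> Pt) u0)) (G Pt) (ob (FObj ?H C))"
      unfolding bij_betw_def
    proof (intro conjI inj_onI equalityI subsetI)
      fix g g' assume g: "g \<in> G Pt" "g' \<in> G Pt" "app (app (?\<nu> Pt) u0) g = app (app (?\<nu> Pt) u0) g'"
      have "app g s = app g' s" if s: "s \<in> elts S" for s
      proof (rule inj_onD[OF bij_betw_imp_inj_on[OF bij]])
        show "app \<phi> (app g s) = app \<phi> (app g' s)"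
          using g(3) s unfolding \<nu>_app[OF g(1)] \<nu>_app[OF g(2)] by (simp add: lam_eq_iff)
      qed (use G_app[OF g(1) s] G_app[OF g(2) s] X in simp_all)
      then have "lam (elts S) (app g) = lam (elts S) (app g')"
        by (simp add: lam_eq_iff)
      then show "g = g'"
        unfolding G_eta[OF g(1)] G_eta[OF g(2)] .
    next
      fix f assume "f \<in> app (app (?\<nu> Pt) u0) ` G Pt"
      then obtain g where g: "g \<in> G Pt" and f: "f = app (app (?\<nu> Pt) u0) g"
        by (rule imageE)
      have "app \<phi> (app g s) \<in> ob C" if "s \<in> elts S" for s
        using G_app[OF g that] bij_betw_apply[OF bij] X by simp
      then show "f \<in> ob (FObj ?H C)"
        unfolding hom_C f \<nu>_app[OF g] by blast
    next
      fix f assume f: "f \<in> ob (FObj ?H C)"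
      have "lam (elts S) (\<lambda>s. \<psi> (app f s)) \<in> G Pt"
        using X \<psi> hom_C_app[OF f] by (intro GI) simp
      then show "f \<in> app (app (?\<nu> Pt) u0) ` G Pt"
        by (rule image_eqI[rotated]) (rule \<nu>_\<psi>[OF f, symmetric])
    qed
    fix f' f assume f: "f' \<in> ob (FObj ?H C)" "f \<in> ob (FObj ?H C)"
    \<comment> \<open>\<open>r\<close> is the infimum over \<open>s\<close> of the distances from
      \<open>f' s\<close> to \<open>f s\<close>. After transport along the isometry every such pair
      lies in level \<open>r\<close> of \<open>X\<close>, and pairing pointwise gives the single map
      \<open>p\<close>. For empty \<open>S\<close> the level is \<open>top\<close>.\<close>
    define r where "r = dist (FObj ?H C) f' f"
    define p where "p = lam (elts S) (\<lambda>s. pair (\<psi> (app f' s)) (\<psi> (app f s)))"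
    have "r \<le> dist X (\<psi> (app f' s)) (\<psi> (app f s))" if s: "s \<in> elts S" for s
    proof -
      have "r \<le> dist C (app f' s) (app f s)"
        using dist_vhom_le[of f' ?S C f s] f s by (simp add: r_def)
      also have "\<dots> = dist X (\<psi> (app f' s)) (\<psi> (app f s))"
        using isom[OF \<psi>(1) \<psi>(1), OF hom_C_app[OF f(1) s] hom_C_app[OF f(2) s]]
        unfolding \<psi>(2)[OF hom_C_app[OF f(1) s]] \<psi>(2)[OF hom_C_app[OF f(2) s]] .
      finally show ?thesis .
    qed
    then have pE: "pair (\<psi> (app f' s)) (\<psi> (app f s)) \<in> elts (F_obj X (Lev r))" if "s \<in> elts S" for s
      using that \<psi>(1) hom_C_app[OF f(1)] hom_C_app[OF f(2)] X by simp
    then have p: "p \<in> G (Lev r)"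
      unfolding p_def by (rule GI)
    have "app (FMap (vcfun_comp ?H ?P) (Lev r) Pt i) p =
        lam (elts S) (\<lambda>s. if i = u0 then \<psi> (app f' s) else \<psi> (app f s))" for i
    proof -
      have "app (FMap (vcfun_comp ?H ?P) (Lev r) Pt i) p =
          lam (elts S) (\<lambda>s. app (FMap (F_fun X) (Lev r) Pt i) (app p s))"
        using p G[of "Lev r"] by (simp add: Gsmall del: F_fun_simps(2) elts_F_obj_Lev)
      also have "\<dots> = lam (elts S) (\<lambda>s. if i = u0 then \<psi> (app f' s) else \<psi> (app f s))"
        using pE by (simp add: p_def lam_eq_iff del: elts_F_obj_Lev)
      finally show ?thesis .
    qed
    then show "\<exists>p\<in>G (Lev (dist (FObj ?H C) f' f)).
        app (app (?\<nu> Pt) u0) (app (FMap (vcfun_comp ?H ?P) (Lev (dist (FObj ?H C) f' f)) Pt u0) p) = f' \<and>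
        app (app (?\<nu> Pt) u0) (app (FMap (vcfun_comp ?H ?P) (Lev (dist (FObj ?H C) f' f)) Pt u1) p) = f"
      unfolding r_def[symmetric]
      using \<nu>_\<psi>[OF f(1)] \<nu>_\<psi>[OF f(2)] by (intro bexI[OF _ p]) (simp only: u0_neq_u1 if_True if_False simp_thms)
  qed
qed

theorem theorem3p22:
  assumes integral: "(1 :: 'v::comm_quantale) = top"
  shows "is_dense SetV VCat (D_fun :: ('u::set_universe, ('u, 'v) vcat, 'u) vcfun)
    \<and> density_presentation SetV VCat (D_fun :: ('u, ('u, 'v) vcat, 'u) vcfun)
        {X :: ('u, 'v) vcat. small_vcat X}
        (\<lambda>X. N_cat) (\<lambda>X. N_weight) (\<lambda>X. vcfun_comp D_fun (F_fun X))"
proof -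
  let ?P = "\<lambda>X. vcfun_comp D_fun (F_fun X) :: ('v nob, ('u, 'v) vcat, 'u) vcfun"
  let ?cs = "closed_subcats SetV VCat (D_fun :: ('u, ('u, 'v) vcat, 'u) vcfun)
    {X :: ('u, 'v) vcat. small_vcat X} (\<lambda>X. N_cat) (\<lambda>X. N_weight) ?P"
  \<comment> \<open>This bounds the intersection from above by \<open>Obj VCat\<close>.\<close>
  have "Obj VCat \<in> ?cs"
    unfolding closed_subcats_def by (auto simp: is_weighted_colimit_iff)
  moreover have "X \<in> T" if T: "T \<in> ?cs" and X: "small_vcat X" for T X
  proof -
    \<comment> \<open>All values of the diagram are images under \<open>D\<close>, so a single
      colimit reaches \<open>X\<close>.\<close>
    have "FObj (?P X) k \<in> T" for k
      using T unfolding closed_subcats_def by simp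
    then show ?thesis
      using T X canonical_colimit[OF X] unfolding closed_subcats_def by blast
  qed
  ultimately have "\<Inter> ?cs = Obj VCat"
    by auto
  moreover have "\<exists>C \<mu>. is_weighted_colimit N_cat VCat N_weight (?P X) C \<mu>" if "small_vcat X" for X
    using canonical_colimit[OF that] by blast
  ultimately show ?thesis
    unfolding density_presentation_def
    using is_dense_D_fun fully_faithful_D_fun[OF integral]
    by (auto simp: is_vcfun_D_F_fun hom_from_D_preserves_colimit[OF integral] simp del: D_fun_simps)
qed

end
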